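(* Let $\sigma\in\mathcal W$ be an arbitrary quasianalytic weight function. (1) If $\omega\in\mathcal W$ is quasianalytic and satisfies $\omega(t)=o(t)$ as $t\to+\infty$, then $j^\infty(\mathcal E^{0,r}_{\{\sigma\}})\cap\Lambda^r_{(\omega)}$ is meager and Haar-null in the Fréchet space $\Lambda^r_{(\omega)}$. (2) If $\omega\in\mathcal W$ is quasianalytic, satisfies $\omega(t)=O(t)$ as $t\to+\infty$, and $\liminf_{t\to+\infty}\omega(t)/t=0$, then $\Lambda^r_{\{\omega\}}\setminus j^\infty(\mathcal E^{0,r}_{\{\sigma\}})$ is dense in $\Lambda^r_{\{\omega\}}$ (and hence so is $\Lambda^r_{\{\omega\}}\setminus j^\infty(\mathcal E^{0,r}_{(\sigma)})$). (3) If $\omega\in\mathcal W$ is quasianalytic and satisfies $\omega(t)=O(t)$ and $\liminf_{t\to+\infty}\omega(t)/t=0$ (Roumieu case), resp. $\omega(t)=o(t)$ as $t\to+\infty$ (Beurling case), then $\Lambda^r_{[\omega]}\setminus j^\infty(\mathcal E^{0,r}_{\{\sigma\}})$ is lineable in $\Lambda^r_{[\omega]}$ (and hence so is $\Lambda^r_{[\omega]}\setminus j^\infty(\mathcal E^{0,r}_{(\sigma)})$).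
   Context: A weight function is a continuous increasing $\omega:[0,\infty)\to[0,\infty)$ with $\omega(t)=0$ for $t\in[0,1]$ and $\omega(t)\to+\infty$ as $t\to+\infty$. $\mathcal W$ is the set of weight functions $\omega$ such that $\omega(2t)=O(\omega(t))$ as $t\to\infty$, $\log t=o(\omega(t))$ as $t\to\infty$, and $\varphi_\omega(t):=\omega(e^t)$ is convex on $\mathbb R$. $\omega$ is quasianalytic if $\int_1^{\infty}\omega(t)/t^2\,dt=+\infty$. $\varphi^*_\omega(x):=\sup_{y\ge0}(xy-\varphi_\omega(y))$ for $x\ge0$. For $U\subseteq\mathbb R^r$ open, $K\subseteq U$ compact, $l>0$: $\|f\|^\omega_{K,l}:=\sup_{\alpha\in\mathbb N^r,x\in K}|\partial^\alpha f(x)|/\exp(\frac1l\varphi^*_\omega(l|\alpha|))$. $\mathcal E_{\{\omega\}}(U)$: smooth $f$ such that for every compact $K\subseteq U$ there exists $l>0$ with $\|f\|^\omega_{K,l}<\infty$; $\mathcal E_{(\omega)}(U)$: for every compact $K$ and every $l>0$. $\mathcal E^{0,r}_{\{\omega\}}$, $\mathcal E^{0,r}_{(\omega)}$ are the corresponding spaces of germs at $0\in\mathbb R^r$ (functions in the class on some cube $(-1/k,1/k)^r$). The sequence spaces are $\Lambda^r_{\{\omega\}}:=\{\mathbf b\in\mathbb C^{\mathbb N^r}:\exists l>0,\ \sup_\alpha|b_\alpha||\alpha|!/\exp(\frac1l\varphi^*_\omega(l|\alpha|))<\infty\}$ (an (LB)-space with the inductive limit topology) and $\Lambda^r_{(\omega)}$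 defined with "for all $l>0$" (a Fréchet space with these seminorms). The Borel map is $j^\infty(f)=(\partial^\alpha f(0)/|\alpha|!)_{\alpha\in\mathbb N^r}$. $[\cdot]$ means $\{\cdot\}$ throughout or $(\cdot)$ throughout. Meager: complement contains a countable intersection of dense open sets. Haar-null (in a complete metric vector space $X$): contained in a Borel set $B$ for which some compactly supported Borel probability measure $\mu$ satisfies $\mu(x+B)=0$ for all $x\in X$. Lineable: the set together with $0$ contains an infinite-dimensional vector subspace. *)

theory Defs
  imports "HOL-Analysis.Analysis" "HOL-Probability.Probability" "HOL-Library.Landau_Symbols"
begin

definition weight_function :: "(real \<Rightarrow> real) \<Rightarrow> bool" where
  "weight_function \<omega> \<longleftrightarrow>
     continuous_on {0..} \<omega> \<and> mono_on {0..} \<omega> \<and> (\<forall>t\<ge>0. \<omega> t \<ge> 0) \<and>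
     (\<forall>t\<in>{0..1}. \<omega> t = 0) \<and> filterlim \<omega> at_top at_top"

definition phi_w :: "(real \<Rightarrow> real) \<Rightarrow> real \<Rightarrow> real" where
  "phi_w \<omega> t = \<omega> (exp t)"

definition W_class :: "(real \<Rightarrow> real) \<Rightarrow> bool" where
  "W_class \<omega> \<longleftrightarrow> weight_function \<omega> \<and>
     (\<lambda>t. \<omega> (2 * t)) \<in> O[at_top](\<omega>) \<and>
     (\<lambda>t. ln t) \<in> o[at_top](\<omega>) \<and>
     convex_on UNIV (phi_w \<omega>)"

definition quasianalytic :: "(real \<Rightarrow> real) \<Rightarrow> bool" where
  "quasianalytic \<omega> \<longleftrightarrow> (\<integral>\<^sup>+ t\<in>{1..}. ennreal (\<omega> t / t\<^sup>2) \<partial>lborel) = \<infinity>"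

definition phi_star :: "(real \<Rightarrow> real) \<Rightarrow> real \<Rightarrow> real" where
  "phi_star \<omega> x = Sup ((\<lambda>y. x * y - phi_w \<omega> y) ` {0..})"

definition wgt :: "(real \<Rightarrow> real) \<Rightarrow> real \<Rightarrow> nat \<Rightarrow> real" where
  "wgt \<omega> l k = exp (phi_star \<omega> (l * real k) / l)"

section \<open>Multi-indices and partial derivatives on R^r (r = CARD('n))\<close>

definition mlen :: "('n::finite \<Rightarrow> nat) \<Rightarrow> nat" where
  "mlen \<alpha> = (\<Sum>i\<in>UNIV. \<alpha> i)"

definition partial_i :: "'n::finite \<Rightarrow> (real^'n \<Rightarrow> complex) \<Rightarrow> real^'n \<Rightarrow> complex" where
  "partial_i i f x = vector_derivative (\<lambda>t. f (x + t *\<^sub>R axis i 1)) (at 0)"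

fun iter_partial :: "'n::finite list \<Rightarrow> (real^'n \<Rightarrow> complex) \<Rightarrow> real^'n \<Rightarrow> complex" where
  "iter_partial [] f = f"
| "iter_partial (i # xs) f = partial_i i (iter_partial xs f)"

definition smooth_on :: "(real^'n::finite) set \<Rightarrow> (real^'n \<Rightarrow> complex) \<Rightarrow> bool" where
  "smooth_on U f \<longleftrightarrow> (\<forall>xs. continuous_on U (iter_partial xs f) \<and>
      (\<forall>i. \<forall>x\<in>U. (\<lambda>t. iter_partial xs f (x + t *\<^sub>R axis i 1)) differentiable (at 0)))"

text \<open>The partial derivative of multi-order alpha (order irrelevant for smooth functions).\<close>
definition pderiv_alpha :: "('n::finite \<Rightarrow> nat) \<Rightarrow> (real^'n \<Rightarrow> complex) \<Rightarrow> real^'n \<Rightarrow> complex" where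
  "pderiv_alpha \<alpha> f = iter_partial (SOME xs. \<forall>i. count_list xs i = \<alpha> i) f"

definition bdd_on :: "(real \<Rightarrow> real) \<Rightarrow> (real^'n::finite) set \<Rightarrow> real \<Rightarrow> (real^'n \<Rightarrow> complex) \<Rightarrow> bool" where
  "bdd_on \<omega> K l f \<longleftrightarrow> (\<exists>C. \<forall>\<alpha>. \<forall>x\<in>K. norm (pderiv_alpha \<alpha> f x) \<le> C * wgt \<omega> l (mlen \<alpha>))"

definition E_roumieu :: "(real \<Rightarrow> real) \<Rightarrow> (real^'n::finite) set \<Rightarrow> (real^'n \<Rightarrow> complex) set" where
  "E_roumieu \<omega> U = {f. smooth_on U f \<and> (\<forall>K. compact K \<and> K \<subseteq> U \<longrightarrow> (\<exists>l>0. bdd_on \<omega> K l f))}"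

definition E_beurling :: "(real \<Rightarrow> real) \<Rightarrow> (real^'n::finite) set \<Rightarrow> (real^'n \<Rightarrow> complex) set" where
  "E_beurling \<omega> U = {f. smooth_on U f \<and> (\<forall>K. compact K \<and> K \<subseteq> U \<longrightarrow> (\<forall>l>0. bdd_on \<omega> K l f))}"

definition cube :: "nat \<Rightarrow> (real^'n::finite) set" where
  "cube k = {x. \<forall>i. \<bar>x $ i\<bar> < 1 / real k}"

definition jet :: "(real^'n::finite \<Rightarrow> complex) \<Rightarrow> ('n \<Rightarrow> nat) \<Rightarrow> complex" where
  "jet f = (\<lambda>\<alpha>. pderiv_alpha \<alpha> f 0 / of_real (fact (mlen \<alpha>)))"

definition jet_germs_roumieu :: "(real \<Rightarrow> real) \<Rightarrow> (('n::finite \<Rightarrow> nat) \<Rightarrow> complex) set" where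
  "jet_germs_roumieu \<sigma> = {jet f | f. \<exists>k::nat. k \<ge> 1 \<and> f \<in> E_roumieu \<sigma> (cube k)}"

definition jet_germs_beurling :: "(real \<Rightarrow> real) \<Rightarrow> (('n::finite \<Rightarrow> nat) \<Rightarrow> complex) set" where
  "jet_germs_beurling \<sigma> = {jet f | f. \<exists>k::nat. k \<ge> 1 \<and> f \<in> E_beurling \<sigma> (cube k)}"

definition seq_bdd :: "(real \<Rightarrow> real) \<Rightarrow> real \<Rightarrow> (('n::finite \<Rightarrow> nat) \<Rightarrow> complex) \<Rightarrow> bool" where
  "seq_bdd \<omega> l b \<longleftrightarrow> (\<exists>C. \<forall>\<alpha>. norm (b \<alpha>) * fact (mlen \<alpha>) \<le> C * wgt \<omega> l (mlen \<alpha>))"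

text \<open>The seminorm sup_alpha |b_alpha| |alpha|! / exp(phi*(l|alpha|)/l) (meaningful for seq_bdd sequences).\<close>
definition snorm :: "(real \<Rightarrow> real) \<Rightarrow> real \<Rightarrow> (('n::finite \<Rightarrow> nat) \<Rightarrow> complex) \<Rightarrow> real" where
  "snorm \<omega> l b = (SUP \<alpha>. norm (b \<alpha>) * fact (mlen \<alpha>) / wgt \<omega> l (mlen \<alpha>))"

definition Lambda_roumieu :: "(real \<Rightarrow> real) \<Rightarrow> (('n::finite \<Rightarrow> nat) \<Rightarrow> complex) set" where
  "Lambda_roumieu \<omega> = {b. \<exists>l>0. seq_bdd \<omega> l b}"

definition Lambda_beurling :: "(real \<Rightarrow> real) \<Rightarrow> (('n::finite \<Rightarrow> nat) \<Rightarrow> complex) set" where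
  "Lambda_beurling \<omega> = {b. \<forall>l>0. seq_bdd \<omega> l b}"

definition sadd :: "('a \<Rightarrow> complex) \<Rightarrow> ('a \<Rightarrow> complex) \<Rightarrow> 'a \<Rightarrow> complex" where
  "sadd a b = (\<lambda>\<alpha>. a \<alpha> + b \<alpha>)"

definition ssub :: "('a \<Rightarrow> complex) \<Rightarrow> ('a \<Rightarrow> complex) \<Rightarrow> 'a \<Rightarrow> complex" where
  "ssub a b = (\<lambda>\<alpha>. a \<alpha> - b \<alpha>)"

definition sscale :: "complex \<Rightarrow> ('a \<Rightarrow> complex) \<Rightarrow> 'a \<Rightarrow> complex" where
  "sscale c a = (\<lambda>\<alpha>. c * a \<alpha>)"

definition open_beurling :: "(real \<Rightarrow> real) \<Rightarrow> (('n::finite \<Rightarrow> nat) \<Rightarrow> complex) set \<Rightarrow> bool" where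
  "open_beurling \<omega> G \<longleftrightarrow> G \<subseteq> Lambda_beurling \<omega> \<and>
     (\<forall>a\<in>G. \<exists>L \<epsilon>. finite L \<and> L \<subseteq> {0<..} \<and> \<epsilon> > 0 \<and>
        (\<forall>b\<in>Lambda_beurling \<omega>. (\<forall>l\<in>L. snorm \<omega> l (ssub b a) < \<epsilon>) \<longrightarrow> b \<in> G))"

definition dense_beurling :: "(real \<Rightarrow> real) \<Rightarrow> (('n::finite \<Rightarrow> nat) \<Rightarrow> complex) set \<Rightarrow> bool" where
  "dense_beurling \<omega> D \<longleftrightarrow> (\<forall>G. open_beurling \<omega> G \<and> G \<noteq> {} \<longrightarrow> G \<inter> D \<noteq> {})"

definition meager_beurling :: "(real \<Rightarrow> real) \<Rightarrow> (('n::finite \<Rightarrow> nat) \<Rightarrow> complex) set \<Rightarrow> bool" where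
  "meager_beurling \<omega> S \<longleftrightarrow> (\<exists>G :: nat \<Rightarrow> (('n \<Rightarrow> nat) \<Rightarrow> complex) set.
     (\<forall>n. open_beurling \<omega> (G n) \<and> dense_beurling \<omega> (G n)) \<and>
     (\<Inter>n. G n) \<subseteq> Lambda_beurling \<omega> - S)"

definition compact_beurling :: "(real \<Rightarrow> real) \<Rightarrow> (('n::finite \<Rightarrow> nat) \<Rightarrow> complex) set \<Rightarrow> bool" where
  "compact_beurling \<omega> C \<longleftrightarrow> C \<subseteq> Lambda_beurling \<omega> \<and>
     (\<forall>\<U>. (\<forall>U\<in>\<U>. open_beurling \<omega> U) \<and> C \<subseteq> \<Union>\<U> \<longrightarrow> (\<exists>\<F>\<subseteq>\<U>. finite \<F> \<and> C \<subseteq> \<Union>\<F>))"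

definition borel_beurling :: "(real \<Rightarrow> real) \<Rightarrow> (('n::finite \<Rightarrow> nat) \<Rightarrow> complex) set set" where
  "borel_beurling \<omega> = sigma_sets (Lambda_beurling \<omega>) {G. open_beurling \<omega> G}"

definition haar_null_beurling :: "(real \<Rightarrow> real) \<Rightarrow> (('n::finite \<Rightarrow> nat) \<Rightarrow> complex) set \<Rightarrow> bool" where
  "haar_null_beurling \<omega> S \<longleftrightarrow> (\<exists>B M. S \<subseteq> B \<and> B \<in> borel_beurling \<omega> \<and>
     space M = Lambda_beurling \<omega> \<and> sets M = borel_beurling \<omega> \<and> prob_space M \<and>
     (\<exists>C. compact_beurling \<omega> C \<and> C \<in> sets M \<and> emeasure M C = 1) \<and>
     (\<forall>x\<in>Lambda_beurling \<omega>. sadd x ` B \<in> sets M \<and> emeasure M (sadd x ` B) = 0))"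

definition absconv :: "('a \<Rightarrow> complex) set \<Rightarrow> bool" where
  "absconv U \<longleftrightarrow> (\<forall>a\<in>U. \<forall>b\<in>U. \<forall>c d::complex. norm c + norm d \<le> 1 \<longrightarrow> sadd (sscale c a) (sscale d b) \<in> U)"

text \<open>U is a 0-neighbourhood of the inductive limit iff it contains an absolutely convex set
  whose trace on every step Banach space {b. seq_bdd l b} (norm snorm l) is a 0-neighbourhood.\<close>
definition open_roumieu :: "(real \<Rightarrow> real) \<Rightarrow> (('n::finite \<Rightarrow> nat) \<Rightarrow> complex) set \<Rightarrow> bool" where
  "open_roumieu \<omega> G \<longleftrightarrow> G \<subseteq> Lambda_roumieu \<omega> \<and>
     (\<forall>a\<in>G. \<exists>U. absconv U \<and>
        (\<forall>l>0. \<exists>\<epsilon>>0. \<forall>b. seq_bdd \<omega> l b \<and> snorm \<omega> l b < \<epsilon> \<longrightarrow> b \<in> U) \<and>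
        (\<forall>u\<in>U. sadd a u \<in> G))"

definition dense_roumieu :: "(real \<Rightarrow> real) \<Rightarrow> (('n::finite \<Rightarrow> nat) \<Rightarrow> complex) set \<Rightarrow> bool" where
  "dense_roumieu \<omega> D \<longleftrightarrow> (\<forall>G. open_roumieu \<omega> G \<and> G \<noteq> {} \<longrightarrow> G \<inter> D \<noteq> {})"

definition lineable :: "(('n::finite \<Rightarrow> nat) \<Rightarrow> complex) set \<Rightarrow> bool" where
  "lineable S \<longleftrightarrow> (\<exists>V. V \<subseteq> S \<union> {(\<lambda>_. 0)} \<and> (\<lambda>_. 0) \<in> V \<and>
     (\<forall>a\<in>V. \<forall>b\<in>V. sadd a b \<in> V) \<and> (\<forall>c. \<forall>a\<in>V. sscale c a \<in> V) \<and>
     (\<forall>n. \<exists>v :: nat \<Rightarrow> ('n \<Rightarrow> nat) \<Rightarrow> complex. (\<forall>i<n. v i \<in> V) \<and>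
        (\<forall>c :: nat \<Rightarrow> complex. (\<forall>\<alpha>. (\<Sum>i<n. c i * v i \<alpha>) = 0) \<longrightarrow> (\<forall>i<n. c i = 0))))"

end

theory Submission
  imports Defs "HOL-Real_Asymp.Real_Asymp"
begin

text \<open>The weights satisfy \<open>wgt \<sigma> l k = sup {t ^ k * exp (- \<sigma> t / l) | t \<ge> 1}\<close>, so they are
  logarithmically convex in \<open>k\<close>, and quasianalyticity of \<open>\<sigma>\<close> says that their successive quotients
  have a divergent sum. Bang's inequality then bounds a function of the class quantitatively: if
  sufficiently many derivatives vanish at 0, it is small on a fixed interval. Consequently a power
  series with long enough gaps can only be the jet of a quasianalytic function if its partial sums
  converge, that is, if it has analytic growth. The hypotheses on \<open>\<omega>\<close> leave room for gap series of
  larger growth in the sequence space; bounded modulations of one such series along disjoint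
  infinite sets of exponents span the subspace required for lineability.

  The jets of the class lie in a linear subspace which is a countable union of sets that are compact
  for the product topology. As it is a proper subspace, it is meager, it has dense complement, and
  every translate of it meets the line through a gap series in at most one point, so the uniform
  measure on a segment of that line witnesses Haar-nullity.\<close>

section \<open>The weight sequences\<close>

text \<open>The order N that Bang's inequality demands depends on the bounds and on the interval,
  not on the function. This lets the gaps be fixed in advance: the gap after the i-th exponent is
  made long enough for all families with parameter \<open>Suc i\<close> and all coefficients up to
  \<open>Suc i\<close> times a partial sum of u, and a given function meets these requirements from
  some i on.

  For the gap series, \<omega> matters only through a sequence u that obeys the bounds of the
  sequence space and exceeds A^j j! at arbitrarily large j, for every A. In the Roumieu case the
  weight with l = 1 serves as u. In the Beurling case u has to lie below all weights at once, up to
  constants, hence an intermediate function between \<omega> and t.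

  Every assertion says that the jets are few or that their complement is large, so it may be proved
  for a larger set of sequences. The enlargement keeps only the derivatives in one direction on a
  segment to one side of 0; mixed derivatives disappear, and closed conditions remain.\<close>

lemma W_classD:
  assumes "W_class \<omega>"
  shows W_class_mono: "\<And>s t. 0 \<le> s \<Longrightarrow> s \<le> t \<Longrightarrow> \<omega> s \<le> \<omega> t"
    and W_class_nonneg: "\<And>t. 0 \<le> t \<Longrightarrow> 0 \<le> \<omega> t"
    and W_class_one: "\<omega> 1 = 0"
    and W_class_ln: "(\<lambda>t. ln t) \<in> o[at_top](\<omega>)"
    and W_class_convex: "convex_on UNIV (\<lambda>t. \<omega> (exp t))"
  using assms by (auto simp: W_class_def weight_function_def mono_on_def phi_w_def[abs_def])

text \<open>\<open>Sup\<close> of an unbounded set of reals is unspecified, so every use of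
  \<open>phi_star\<close> rests on this bound. As ln t = o(\<omega>(t)), eventually \<omega>(e^y) >=
  (x + 1) y, and the remaining y form a bounded interval.\<close>

lemma bdd_above_phi_star:
  assumes "W_class \<omega>" "0 \<le> x"
  shows "bdd_above ((\<lambda>y. x * y - phi_w \<omega> y) ` {0..})"
proof -
  have "\<forall>\<^sub>F t in at_top. norm (ln t) \<le> 1 / (x + 1) * norm (\<omega> t)"
    using landau_o.smallD[OF W_class_ln[OF assms(1)], of "1 / (x + 1)"] assms(2) by simp
  then obtain T where T: "\<And>t. t \<ge> T \<Longrightarrow> norm (ln t) \<le> 1 / (x + 1) * norm (\<omega> t)"
    unfolding eventually_at_top_linorder by blast
  have "x * y - phi_w \<omega> y \<le> x * \<bar>T\<bar>" if y: "y \<ge> 0" for y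
  proof (cases "y \<le> \<bar>T\<bar>")
    case True
    then show ?thesis
      using W_class_nonneg[OF assms(1), of "exp y"] mult_left_mono[OF True assms(2)]
      by (auto simp: phi_w_def)
  next
    case False
    moreover have "exp y \<ge> 1 + y" by simp
    ultimately have "T \<le> exp y" by linarith
    from T[OF this] have "y \<le> 1 / (x + 1) * \<omega> (exp y)"
      using y W_class_nonneg[OF assms(1), of "exp y"] by simp
    then have "(x + 1) * y \<le> \<omega> (exp y)"
      using assms(2) by (simp add: field_simps)
    then have "x * y - phi_w \<omega> y \<le> 0" using y by (simp add: phi_w_def algebra_simps)
    also have "0 \<le> x * \<bar>T\<bar>" using assms(2) by simp
    finally show ?thesis .
  qed
  then show ?thesis by (auto intro!: bdd_aboveI2)
qed

text \<open>With y = ln t the conjugate becomes a supremum of moments. Together with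
  \<open>wgt_le\<close> this characterises \<open>wgt\<close> as a least upper bound; later facts on
  the weights are proved for one t at a time, without returning to \<open>phi_star\<close>.\<close>

lemma power_le_wgt:
  assumes "W_class \<omega>" "l > 0" "t \<ge> 1"
  shows "t ^ k * exp (- (\<omega> t / l)) \<le> wgt \<omega> l k"
proof -
  have "l * real k * ln t - phi_w \<omega> (ln t) \<le> phi_star \<omega> (l * real k)"
    unfolding phi_star_def using assms
    by (intro cSup_upper bdd_above_phi_star) auto
  then have "real k * ln t - \<omega> t / l \<le> phi_star \<omega> (l * real k) / l"
    using assms by (simp add: phi_w_def pos_le_divide_eq) (simp add: algebra_simps)
  moreover have "t ^ k * exp (- (\<omega> t / l)) = exp (real k * ln t - \<omega> t / l)"
    using assms by (simp add: exp_diff exp_minus divide_inverse exp_of_nat_mult)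
  ultimately show ?thesis by (simp add: wgt_def)
qed

lemma wgt_le:
  assumes "l > 0" "C > 0" and le: "\<And>t. t \<ge> 1 \<Longrightarrow> t ^ k * exp (- (\<omega> t / l)) \<le> C"
  shows "wgt \<omega> l k \<le> C"
proof -
  have "phi_star \<omega> (l * real k) \<le> l * ln C"
    unfolding phi_star_def
  proof (rule cSup_least, goal_cases)
    case (2 z)
    then obtain y where y: "y \<ge> 0" "z = l * real k * y - phi_w \<omega> y" by auto
    have "exp (real k * y - \<omega> (exp y) / l) = exp y ^ k * exp (- (\<omega> (exp y) / l))"
      by (simp add: exp_diff exp_minus divide_inverse exp_of_nat_mult)
    also have "\<dots> \<le> C" using le[of "exp y"] y by simp
    finally have "real k * y - \<omega> (exp y) / l \<le> ln C"
      using assms(2) by (simp add: ln_ge_iff)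
    then show ?case using assms(1) by (simp add: y phi_w_def field_simps)
  qed auto
  then have "phi_star \<omega> (l * real k) / l \<le> ln C" using assms(1) by (simp add: field_simps)
  then show ?thesis using assms(2) by (simp add: wgt_def ln_ge_iff)
qed

section \<open>Monotonicity and logarithmic convexity of the weights\<close>

lemma wgt_pos: "wgt \<omega> l k > 0"
  by (simp add: wgt_def)

lemma wgt_ge_1:
  assumes "W_class \<omega>" "l > 0"
  shows "wgt \<omega> l k \<ge> 1"
  using power_le_wgt[OF assms, of 1 k] W_class_one[OF assms(1)] by simp

lemma wgt_0:
  assumes "W_class \<omega>" "l > 0"
  shows "wgt \<omega> l 0 = 1"
proof (rule antisym)
  show "wgt \<omega> l 0 \<le> 1"
    using assms W_class_nonneg[OF assms(1)] by (intro wgt_le) auto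
qed (rule wgt_ge_1[OF assms])

lemma wgt_mono:
  assumes "W_class \<omega>" "0 < l" "l \<le> l'"
  shows "wgt \<omega> l k \<le> wgt \<omega> l' k"
proof (rule wgt_le)
  fix t :: real assume t: "t \<ge> 1"
  have "\<omega> t / l' \<le> \<omega> t / l"
    using assms W_class_nonneg[OF assms(1), of t] t by (intro divide_left_mono) auto
  then have "t ^ k * exp (- (\<omega> t / l)) \<le> t ^ k * exp (- (\<omega> t / l'))"
    using t by (intro mult_left_mono) auto
  also have "\<dots> \<le> wgt \<omega> l' k" using assms t by (intro power_le_wgt) auto
  finally show "t ^ k * exp (- (\<omega> t / l)) \<le> wgt \<omega> l' k" .
qed (use assms wgt_pos in auto)

lemma wgt_Suc:
  assumes "W_class \<omega>" "0 < l"
  shows "wgt \<omega> l k \<le> wgt \<omega> l (Suc k)"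
proof (rule wgt_le)
  fix t :: real assume t: "t \<ge> 1"
  have "t ^ k * exp (- (\<omega> t / l)) \<le> t ^ Suc k * exp (- (\<omega> t / l))"
    using t by (intro mult_right_mono power_increasing) auto
  also have "\<dots> \<le> wgt \<omega> l (Suc k)" using assms t by (intro power_le_wgt) auto
  finally show "t ^ k * exp (- (\<omega> t / l)) \<le> wgt \<omega> l (Suc k)" .
qed (use assms wgt_pos in auto)

text \<open>For fixed t the moments form a geometric sequence in k, so the square of the middle one
  is the product of its neighbours; passing to suprema leaves an inequality.\<close>

lemma wgt_log_convex:
  assumes "W_class \<omega>" "0 < l"
  shows "(wgt \<omega> l (Suc k))\<^sup>2 \<le> wgt \<omega> l k * wgt \<omega> l (Suc (Suc k))"
proof -
  define P where "P = wgt \<omega> l k * wgt \<omega> l (Suc (Suc k))"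
  have P: "P > 0" by (simp add: P_def wgt_pos)
  have "wgt \<omega> l (Suc k) \<le> sqrt P"
  proof (rule wgt_le)
    fix t :: real assume t: "t \<ge> 1"
    have "(t ^ Suc k * exp (- (\<omega> t / l)))\<^sup>2
        = (t ^ k * exp (- (\<omega> t / l))) * (t ^ Suc (Suc k) * exp (- (\<omega> t / l)))"
      by (simp add: power2_eq_square)
    also have "\<dots> \<le> P"
      unfolding P_def using t assms wgt_pos[of \<omega> l k]
      by (intro mult_mono power_le_wgt) auto
    finally show "t ^ Suc k * exp (- (\<omega> t / l)) \<le> sqrt P"
      by (rule real_le_rsqrt)
  qed (use assms P in auto)
  then have "(wgt \<omega> l (Suc k))\<^sup>2 \<le> (sqrt P)\<^sup>2"
    using wgt_pos[of \<omega> l "Suc k"] by (intro power_mono) auto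
  then show ?thesis using P by (simp add: P_def)
qed

lemma wgt_ratio_mono:
  assumes "W_class \<omega>" "0 < l" "i \<le> j"
  shows "wgt \<omega> l (Suc i) / wgt \<omega> l i \<le> wgt \<omega> l (Suc j) / wgt \<omega> l j"
proof -
  have "mono (\<lambda>i. wgt \<omega> l (Suc i) / wgt \<omega> l i)"
    unfolding mono_iff_le_Suc
    using wgt_log_convex[OF assms(1,2)] wgt_pos[of \<omega> l]
    by (auto simp: divide_simps power2_eq_square mult.commute)
  then show ?thesis using assms(3) by (simp add: mono_def)
qed

text \<open>The link between the integral and the series: one quotient m contributes exactly its
  reciprocal to the integral of the weight against t^-2.\<close>

lemma nn_integral_ln_over_square:
  fixes m :: real
  assumes "m \<ge> 1"
  shows "(\<integral>\<^sup>+ t\<in>{1..}. ennreal (max 0 (ln (t / m)) / t\<^sup>2) \<partial>lborel) = ennreal (1 / m)"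
proof -
  have "(\<integral>\<^sup>+ t\<in>{1..}. ennreal (max 0 (ln (t / m)) / t\<^sup>2) \<partial>lborel)
      = (\<integral>\<^sup>+ t. ennreal (ln (t / m) / t\<^sup>2) * indicator {m..} t \<partial>lborel)"
  proof (rule nn_integral_cong)
    fix t :: real
    show "ennreal (max 0 (ln (t / m)) / t\<^sup>2) * indicator {1..} t
        = ennreal (ln (t / m) / t\<^sup>2) * indicator {m..} t"
      using assms by (cases "t \<ge> m"; cases "t \<ge> 1") (auto simp: max_def ln_ge_zero_iff)
  qed
  also have "\<dots> = ennreal (0 - (- (ln (m / m) + 1) / m))"
  proof (rule nn_integral_FTC_atLeast[where F = "\<lambda>t. - (ln (t / m) + 1) / t" and T = 0])
    fix t assume t: "m \<le> t"
    show "((\<lambda>t. - (ln (t / m) + 1) / t) has_real_derivative ln (t / m) / t\<^sup>2) (at t)"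
      using t assms
      by (auto intro!: derivative_eq_intros simp: field_simps power2_eq_square)
    show "0 \<le> ln (t / m) / t\<^sup>2" using t assms by simp
  next
    show "((\<lambda>t. - (ln (t / m) + 1) / t) \<longlongrightarrow> 0) at_top"
      using assms by real_asymp
  qed measurable
  finally show ?thesis using assms by simp
qed

text \<open>The supporting line of the convex function \<open>\<omega> \<circ> exp\<close> at \<open>ln t\<close> has some slope
  \<open>s \<ge> 0\<close>, and the index \<open>\<lfloor>s\<rfloor>\<close> nearly recovers \<open>\<omega> t\<close> from the conjugate.\<close>

lemma weight_le_ln_wgt:
  assumes \<omega>: "W_class \<omega>" and l: "l > 0" and t: "t \<ge> 1"
  shows "\<exists>j. \<omega> t / l \<le> real (Suc j) * ln t - ln (wgt \<omega> l j)"
proof -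
  define \<phi> where "\<phi> = (\<lambda>y. \<omega> (exp y) / l)"
  have "convex_on UNIV \<phi>"
    using W_class_convex[OF \<omega>] l unfolding \<phi>_def by (intro convex_on_cdiv) auto
  then obtain s where s: "\<And>z. \<phi> z \<ge> \<phi> (ln t) + s * (z - ln t)"
    using convex_le_Inf_differential[of UNIV \<phi> "ln t"] by auto
  have "s \<ge> 0"
  proof -
    have "\<phi> (ln t - 1) \<le> \<phi> (ln t)"
      unfolding \<phi>_def using l by (intro divide_right_mono W_class_mono[OF \<omega>]) auto
    with s[of "ln t - 1"] show ?thesis by simp
  qed
  define j where "j = nat \<lfloor>s\<rfloor>"
  have j: "real j \<le> s" "s \<le> real (Suc j)"
    using \<open>s \<ge> 0\<close> unfolding j_def by linarith+
  have "wgt \<omega> l j \<le> exp (s * ln t - \<omega> t / l)"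
  proof (rule wgt_le)
    fix x :: real assume x: "x \<ge> 1"
    have "x ^ j * exp (- (\<omega> x / l)) = exp (real j * ln x - \<phi> (ln x))"
      using x by (simp add: \<phi>_def exp_diff exp_minus divide_inverse exp_of_nat_mult)
    also have "\<dots> \<le> exp (s * ln t - \<phi> (ln t))"
    proof -
      have "real j * ln x \<le> s * ln x" using j x by (intro mult_right_mono) auto
      then show ?thesis using s[of "ln x"] by (simp add: algebra_simps)
    qed
    finally show "x ^ j * exp (- (\<omega> x / l)) \<le> exp (s * ln t - \<omega> t / l)"
      using t by (simp add: \<phi>_def)
  qed (use l in auto)
  then have "ln (wgt \<omega> l j) \<le> s * ln t - \<omega> t / l"
    by (metis ln_exp ln_le_cancel_iff wgt_pos exp_gt_zero)
  \<comment> \<open>Rounding s down in the weight and up here costs one extra \<open>ln t\<close>;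
    this is the \<open>Suc\<close> in the statement.\<close>
  moreover have "s * ln t \<le> real (Suc j) * ln t" using j t by (intro mult_right_mono) auto
  ultimately show ?thesis by (intro exI[of _ j]) linarith
qed

text \<open>Since the weight of order 0 is 1, the weight of order j is the product of the first j
  quotients m i. Hence \<omega>(t) / l is at most ln t plus the sum of the positive parts of ln (t /
  m i), and integration against t^-2 bounds the divergent integral by l (1 + sum of 1 / m
  i).\<close>

proposition quasianalytic_not_summable:
  assumes \<omega>: "W_class \<omega>" and q: "quasianalytic \<omega>" and l: "l > 0"
  shows "\<not> summable (\<lambda>j. wgt \<omega> l j / wgt \<omega> l (Suc j))"
proof
  assume sm: "summable (\<lambda>j. wgt \<omega> l j / wgt \<omega> l (Suc j))"
  define m where "m = (\<lambda>j. wgt \<omega> l (Suc j) / wgt \<omega> l j)"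
  have m: "m j \<ge> 1" for j
    using wgt_Suc[OF \<omega> l] wgt_pos[of \<omega> l j] by (simp add: m_def)
  have W: "ln (wgt \<omega> l j) = (\<Sum>i<j. ln (m i))" for j
  proof (induction j)
    case (Suc j)
    have "ln (m j) = ln (wgt \<omega> l (Suc j)) - ln (wgt \<omega> l j)"
      unfolding m_def by (intro ln_divide_pos wgt_pos)
    with Suc show ?case by simp
  qed (simp add: wgt_0[OF \<omega> l])
  \<comment> \<open>The extra \<open>ln t\<close> is written as one more quotient, equal to 1, so
    that the same integral formula covers it.\<close>
  have bound: "ennreal (\<omega> t / t\<^sup>2) \<le> ennreal l *
      (ennreal (max 0 (ln (t / 1)) / t\<^sup>2) + (\<Sum>i. ennreal (max 0 (ln (t / m i)) / t\<^sup>2)))"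
    if t: "t \<ge> 1" for t
  proof -
    obtain j where j: "\<omega> t / l \<le> real (Suc j) * ln t - ln (wgt \<omega> l j)"
      using weight_le_ln_wgt[OF \<omega> l t] by blast
    have "real j * ln t - ln (wgt \<omega> l j) = (\<Sum>i<j. ln t - ln (m i))"
      by (simp add: W sum_subtractf)
    also have "\<dots> \<le> (\<Sum>i<j. max 0 (ln (t / m i)))"
    proof (rule sum_mono)
      fix i show "ln t - ln (m i) \<le> max 0 (ln (t / m i))"
        using t m[of i] by (simp add: ln_div)
    qed
    finally have "\<omega> t / l \<le> max 0 (ln (t / 1)) + (\<Sum>i<j. max 0 (ln (t / m i)))"
      using j by (simp add: algebra_simps)
    then have "\<omega> t / t\<^sup>2 \<le>
        l * (max 0 (ln (t / 1)) / t\<^sup>2 + (\<Sum>i<j. max 0 (ln (t / m i)) / t\<^sup>2))"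
      using l t by (simp add: field_simps flip: sum_divide_distrib)
    then have "ennreal (\<omega> t / t\<^sup>2) \<le> ennreal (l *
        (max 0 (ln (t / 1)) / t\<^sup>2 + (\<Sum>i<j. max 0 (ln (t / m i)) / t\<^sup>2)))"
      by (rule ennreal_leI)
    also have "\<dots> = ennreal l * (ennreal (max 0 (ln (t / 1)) / t\<^sup>2)
        + (\<Sum>i<j. ennreal (max 0 (ln (t / m i)) / t\<^sup>2)))"
      using l by (simp add: ennreal_mult ennreal_plus sum_nonneg sum_ennreal del: div_by_1)
    also have "\<dots> \<le> ennreal l * (ennreal (max 0 (ln (t / 1)) / t\<^sup>2)
        + (\<Sum>i. ennreal (max 0 (ln (t / m i)) / t\<^sup>2)))"
      by (intro mult_left_mono add_left_mono sum_le_suminf) auto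
    finally show ?thesis .
  qed
  have "(\<integral>\<^sup>+ t\<in>{1..}. ennreal (\<omega> t / t\<^sup>2) \<partial>lborel)
      \<le> (\<integral>\<^sup>+ t. ennreal l * (ennreal (max 0 (ln (t / 1)) / t\<^sup>2) * indicator {1..} t
          + (\<Sum>i. ennreal (max 0 (ln (t / m i)) / t\<^sup>2) * indicator {1..} t)) \<partial>lborel)"
  proof (rule nn_integral_mono)
    fix t :: real
    show "ennreal (\<omega> t / t\<^sup>2) * indicator {1..} t \<le> ennreal l *
        (ennreal (max 0 (ln (t / 1)) / t\<^sup>2) * indicator {1..} t
          + (\<Sum>i. ennreal (max 0 (ln (t / m i)) / t\<^sup>2) * indicator {1..} t))"
    proof (cases "t \<ge> 1")
      case True
      then have "indicator {1..} t = (1::ennreal)" by simp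
      then show ?thesis using bound[OF True] by (simp only: mult_1_right)
    qed simp
  qed
  also have "\<dots> = ennreal l * ((\<integral>\<^sup>+ t\<in>{1..}. ennreal (max 0 (ln (t / 1)) / t\<^sup>2) \<partial>lborel)
      + (\<Sum>i. \<integral>\<^sup>+ t\<in>{1..}. ennreal (max 0 (ln (t / m i)) / t\<^sup>2) \<partial>lborel))"
    by (subst nn_integral_cmult, measurable, subst nn_integral_add, measurable,
        subst nn_integral_suminf, measurable)
  also have "\<dots> = ennreal l * (ennreal (1 / 1) + (\<Sum>i. ennreal (1 / m i)))"
    by (subst nn_integral_ln_over_square, simp, subst nn_integral_ln_over_square[OF m], rule refl)
  also have "\<dots> < \<infinity>"
  proof -
    have "(\<Sum>i. ennreal (1 / m i)) = ennreal (\<Sum>i. 1 / m i)"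
      using sm m by (intro suminf_ennreal2) (auto simp: m_def intro!: divide_nonneg_nonneg less_imp_le[OF wgt_pos])
    then show ?thesis by (simp add: ennreal_mult_less_top)
  qed
  finally show False using q by (simp add: quasianalytic_def)
qed

section \<open>Bang's inequality\<close>

text \<open>\<open>start\<close> says that Bang's norm at x, the supremum over j of norm (G j x) /
  (e^j M j), is at most b. As long as b is at least e^-(k+1), the norm grows at most exponentially
  with rate e M (k+1) / M k: the orders above k satisfy the claim trivially, so only finitely many
  differential inequalities remain.\<close>

lemma bang_step:
  fixes G :: "nat \<Rightarrow> real \<Rightarrow> 'a::real_normed_vector" and M :: "nat \<Rightarrow> real"
  assumes M: "\<And>j. M j > 0"
    and ratio: "\<And>i j. i \<le> j \<Longrightarrow> M (Suc i) / M i \<le> M (Suc j) / M j"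
    and der: "\<And>j t. t \<in> {x..y} \<Longrightarrow> (G j has_vector_derivative G (Suc j) t) (at t within {x..y})"
    and bd: "\<And>j t. t \<in> {x..y} \<Longrightarrow> norm (G j t) \<le> M j"
    and b: "exp (- real (Suc k)) \<le> b"
    and start: "\<And>j. norm (G j x) \<le> b * exp (real j) * M j"
    and t: "t \<in> {x..y}"
  shows "norm (G j t) \<le> b * exp (real j) * M j * exp (exp 1 * (M (Suc k) / M k) * (t - x))"
proof -
  define E where "E = (\<lambda>t. exp (exp 1 * (M (Suc k) / M k) * (t - x)))"
  have b0: "b > 0" using b by (meson exp_gt_zero less_le_trans)
  have E1: "E t \<ge> 1" if "t \<ge> x" for t
    using that less_imp_le[OF M] by (auto simp: E_def)
  \<comment> \<open>For these orders b e^j >= 1, so the a priori bound M j suffices.\<close>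
  have large: "norm (G j t) \<le> b * exp (real j) * M j * E t" if "j \<ge> Suc k" "t \<in> {x..y}" for j t
  proof -
    have "1 \<le> exp (- real (Suc k)) * exp (real j)"
      using that by (simp flip: exp_add)
    also have "\<dots> \<le> b * exp (real j)" using b by (intro mult_right_mono) auto
    finally have "1 * M j * 1 \<le> b * exp (real j) * M j * E t"
      using that E1[of t] M[of j] b0 by (intro mult_mono mult_nonneg_nonneg) auto
    then show ?thesis using bd[OF that(2), of j] by simp
  qed
  \<comment> \<open>Downward induction: the bound for order n + 1 is integrated from x to give the
    one for order n.\<close>
  have small: "\<forall>t\<in>{x..y}. norm (G j t) \<le> b * exp (real j) * M j * E t" if "j \<le> Suc k" for j
    using that
  proof (induction rule: inc_induct)
    case base
    show ?case using large by blast
  next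
    case (step n)
    show ?case
    proof
      fix t assume t: "t \<in> {x..y}"
      show "norm (G n t) \<le> b * exp (real n) * M n * E t"
      proof (cases "t = x")
        case True
        then show ?thesis using start[of n] by (simp add: E_def)
      next
        case False
        then have xt: "x < t" using t by simp
        define \<phi> where "\<phi> = (\<lambda>s. b * exp (real n) * M n * E s)"
        define \<phi>' where "\<phi>' = (\<lambda>s. b * exp (real n) * M n * (E s * (exp 1 * (M (Suc k) / M k))))"
        have d\<phi>: "(\<phi> has_vector_derivative \<phi>' s) (at s)" for s
          unfolding \<phi>_def \<phi>'_def E_def has_real_derivative_iff_has_vector_derivative[symmetric]
          using M[of k] by (auto intro!: derivative_eq_intros)
        have "norm (G n t - G n x) \<le> \<phi> t - \<phi> x"
        proof (rule differentiable_bound_general[OF xt])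
          show "continuous_on {x..t} (G n)"
            using t by (intro continuous_on_vector_derivative[of _ _ "G (Suc n)"]
                has_vector_derivative_within_subset[OF der]) auto
          show "continuous_on {x..t} \<phi>"
            unfolding \<phi>_def E_def by (intro continuous_intros)
          fix s assume s: "x < s" "s < t"
          have "at s within {x..y} = at s" using s t by (intro at_within_Icc_at) auto
          then show "(G n has_vector_derivative G (Suc n) s) (at s)"
            using der[of s n] s t by simp
          show "(\<phi> has_vector_derivative \<phi>' s) (at s)" by (rule d\<phi>)
          \<comment> \<open>The increasing quotients enter here: since n <= k, the rate for order n
            is dominated by the common rate.\<close>
          have "M (Suc n) \<le> M (Suc k) / M k * M n"
            using ratio[of n k] step.hyps M[of n] by (simp add: field_simps)
          then have "b * exp (real n) * exp 1 * E s * M (Suc n)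
              \<le> b * exp (real n) * exp 1 * E s * (M (Suc k) / M k * M n)"
            using b0 by (intro mult_left_mono) (auto simp: E_def)
          moreover have "norm (G (Suc n) s) \<le> b * exp (real (Suc n)) * M (Suc n) * E s"
            using step.IH s t by auto
          moreover have "exp (real (Suc n)) = exp (real n) * exp 1"
            by (simp flip: exp_add add: add.commute)
          ultimately show "norm (G (Suc n) s) \<le> \<phi>' s"
            by (simp add: \<phi>'_def mult_ac)
        qed
        moreover have "\<phi> x = b * exp (real n) * M n" by (simp add: \<phi>_def E_def)
        moreover have "norm (G n t) \<le> norm (G n t - G n x) + norm (G n x)"
          by (metis diff_add_cancel norm_triangle_ineq)
        ultimately have "norm (G n t) \<le> \<phi> t" using start[of n] by linarith
        then show ?thesis by (simp add: \<phi>_def)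
      qed
    qed
  qed
  show ?thesis
    using large[of j t] small[of j] t unfolding E_def by (cases "j \<ge> Suc k") auto
qed

text \<open>By \<open>bang_step\<close>, Bang's norm needs at least the length M k / (e M (k+1)) to
  grow from e^-(k+1) to e^-k. At 0 it is at most e^-N because the first N derivatives vanish; the
  induction descends from N to k and adds up these lengths.\<close>

lemma bang_bound:
  fixes G :: "nat \<Rightarrow> real \<Rightarrow> 'a::real_normed_vector" and M :: "nat \<Rightarrow> real"
  assumes M: "\<And>j. M j > 0"
    and ratio: "\<And>i j. i \<le> j \<Longrightarrow> M (Suc i) / M i \<le> M (Suc j) / M j"
    and der: "\<And>j t. t \<in> {0..a} \<Longrightarrow> (G j has_vector_derivative G (Suc j) t) (at t within {0..a})"
    and bd: "\<And>j t. t \<in> {0..a} \<Longrightarrow> norm (G j t) \<le> M j"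
    and zero: "\<And>j. j < N \<Longrightarrow> G j 0 = 0"
    and "k \<le> N"
    and "t \<in> {0..a}" "t \<le> (\<Sum>i=k..<N. M i / M (Suc i) / exp 1)"
  shows "norm (G j t) \<le> exp (- real k) * exp (real j) * M j"
  using assms(6-8)
proof (induction k arbitrary: t j rule: inc_induct)
  case base
  then have "t = 0" by simp
  show ?case
  proof (cases "j < N")
    case True
    then show ?thesis using zero \<open>t = 0\<close> less_imp_le[OF M] by simp
  next
    case False
    then have "1 * M j \<le> exp (- real N) * exp (real j) * M j"
      using M[of j] by (intro mult_right_mono) (auto simp flip: exp_add)
    then show ?thesis using bd[OF base(1), of j] by simp
  qed
next
  case (step k)
  define S where "S = (\<Sum>i=Suc k..<N. M i / M (Suc i) / exp 1)"
  \<comment> \<open>At x the induction hypothesis still gives the level e^-(k+1); what remains up to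
    t is at most one such length.\<close>
  define x where "x = min t S"
  have S0: "S \<ge> 0" unfolding S_def using less_imp_le[OF M] by (intro sum_nonneg) auto
  have x: "x \<in> {0..a}" "x \<le> S" "x \<le> t" using S0 step.prems by (auto simp: x_def)
  have "t \<le> M k / M (Suc k) / exp 1 + S"
    using step by (simp add: S_def sum.atLeast_Suc_lessThan)
  moreover have "M k / M (Suc k) / exp 1 \<ge> 0" using less_imp_le[OF M] by simp
  ultimately have tx: "t - x \<le> M k / M (Suc k) / exp 1" by (auto simp: x_def min_def)
  have "norm (G j t) \<le> exp (- real (Suc k)) * exp (real j) * M j *
      exp (exp 1 * (M (Suc k) / M k) * (t - x))"
  proof (rule bang_step[where y = t])
    fix i s assume s: "s \<in> {x..t}"
    show "norm (G i s) \<le> M i" using s x step.prems by (intro bd) auto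
    show "(G i has_vector_derivative G (Suc i) s) (at s within {x..t})"
      using s x step.prems
      by (intro has_vector_derivative_within_subset[OF der]) auto
  next
    fix i show "norm (G i x) \<le> exp (- real (Suc k)) * exp (real i) * M i"
      using step.IH[OF x(1)] x(2) by (simp add: S_def)
  qed (use M ratio x in auto)
  also have "\<dots> \<le> exp (- real (Suc k)) * exp (real j) * M j * exp 1"
  proof -
    have "exp 1 * (M (Suc k) / M k) * (t - x)
        \<le> exp 1 * (M (Suc k) / M k) * (M k / M (Suc k) / exp 1)"
      using tx less_imp_le[OF M] by (intro mult_left_mono) auto
    also have "\<dots> = 1" using M[of k] M[of "Suc k"] by (simp add: field_simps)
    finally show ?thesis using less_imp_le[OF M] by (intro mult_left_mono) auto
  qed
  also have "\<dots> = exp (- real k) * exp (real j) * M j"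
    by (simp add: mult_ac flip: exp_add)
  finally show ?case .
qed

text \<open>N depends on M, R, a and \<epsilon> but not on G; the choice of the gaps relies on this
  uniformity. The level k is fixed by e^-k R M 0 < \<epsilon>, then N by the divergence, so that the
  lengths from k to N - 1 add up to more than a.\<close>

proposition high_order_zero_imp_small:
  fixes M :: "nat \<Rightarrow> real"
  assumes M: "\<And>j. M j > 0"
    and ratio: "\<And>i j. i \<le> j \<Longrightarrow> M (Suc i) / M i \<le> M (Suc j) / M j"
    and div: "\<not> summable (\<lambda>j. M j / M (Suc j))"
    and R: "R > 0" and \<epsilon>: "\<epsilon> > 0"
  shows "\<exists>N. \<forall>G :: nat \<Rightarrow> real \<Rightarrow> 'a::real_normed_vector.
    (\<forall>j. \<forall>t\<in>{0..a}. (G j has_vector_derivative G (Suc j) t) (at t within {0..a})) \<longrightarrow>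
    (\<forall>j. \<forall>t\<in>{0..a}. norm (G j t) \<le> R * M j) \<longrightarrow> (\<forall>j<N. G j 0 = 0) \<longrightarrow>
    (\<forall>t\<in>{0..a}. norm (G 0 t) \<le> \<epsilon>)"
proof -
  have "(\<lambda>k. exp (- real k) * (R * M 0)) \<longlonglongrightarrow> 0 * (R * M 0)"
    by (intro tendsto_intros) real_asymp
  then have "\<forall>\<^sub>F k in sequentially. exp (- real k) * (R * M 0) < \<epsilon>"
    using \<epsilon> by (auto dest: order_tendstoD(2))
  then obtain k where k: "exp (- real k) * (R * M 0) < \<epsilon>"
    by (auto simp: eventually_sequentially)
  define f where "f = (\<lambda>i. M i / M (Suc i) / exp 1)"
  have f0: "f i \<ge> 0" for i using less_imp_le[OF M] by (simp add: f_def)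
  have "\<not> summable f"
    using div summable_mult[of f "exp 1"] by (auto simp: f_def)
  then have "\<not> summable (\<lambda>i. f (i + k))" by (simp add: summable_iff_shift)
  have "\<exists>n. (\<Sum>i<n. f (i + k)) > a"
  proof (rule ccontr)
    assume "\<not> ?thesis"
    then have "(\<Sum>i\<le>n. f (i + k)) \<le> a" for n
      by (metis lessThan_Suc_atMost not_less)
    then have "summable (\<lambda>i. f (i + k))"
      using f0 by (intro bounded_imp_summable[where B = a]) auto
    then show False using \<open>\<not> summable (\<lambda>i. f (i + k))\<close> by simp
  qed
  then obtain n where n: "(\<Sum>i<n. f (i + k)) > a" ..
  have "(\<Sum>i<n. f (i + k)) = (\<Sum>i=k..<n + k. f i)"
    by (metis add_0 atLeast0LessThan sum.shift_bounds_nat_ivl)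
  with n have n': "(\<Sum>i=k..<n + k. f i) > a" by simp
  show ?thesis
  proof (intro exI[of _ "n + k"] allI impI ballI)
    fix G :: "nat \<Rightarrow> real \<Rightarrow> 'a" and t
    assume *: "\<forall>j. \<forall>t\<in>{0..a}. (G j has_vector_derivative G (Suc j) t) (at t within {0..a})"
      "\<forall>j. \<forall>t\<in>{0..a}. norm (G j t) \<le> R * M j" "\<forall>j<n + k. G j 0 = 0" "t \<in> {0..a}"
    have "norm (G 0 t) \<le> exp (- real k) * exp (real 0) * (R * M 0)"
    proof (rule bang_bound[where a = a and N = "n + k"])
      \<comment> \<open>The factor R cancels in the quotients, so the lengths do not shrink.\<close>
      show "t \<le> (\<Sum>i=k..<n + k. R * M i / (R * M (Suc i)) / exp 1)"
        using n' *(4) R by (simp add: f_def)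
    qed (use * M R ratio in auto)
    then show "norm (G 0 t) \<le> \<epsilon>" using k by simp
  qed
qed

section \<open>Jets along a half-line\<close>

text \<open>A family \<open>G\<close> of successive derivatives on \<open>[0, 1/l]\<close>. The derivative relation is encoded
  by a quadratic remainder estimate, a condition that survives pointwise limits.\<close>

definition jet_family :: "(real \<Rightarrow> real) \<Rightarrow> real \<Rightarrow> (nat \<Rightarrow> real \<Rightarrow> complex) \<Rightarrow> bool" where
  "jet_family \<sigma> l G \<longleftrightarrow>
     (\<forall>j. \<forall>t\<in>{0..1/l}. norm (G j t) \<le> l * wgt \<sigma> l j) \<and>
     (\<forall>j. \<forall>s\<in>{0..1/l}. \<forall>t\<in>{0..1/l}.
        norm (G j t - G j s - (t - s) *\<^sub>R G (Suc j) s) \<le> l * wgt \<sigma> l (j + 2) * (t - s)\<^sup>2)"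

text \<open>The parameter l is at once the weight parameter, the constant in the bounds and the
  reciprocal of the length of the interval. Merging the three makes the sets increase with l, so
  integer values suffice.\<close>

definition ray_jets :: "(real \<Rightarrow> real) \<Rightarrow> real \<Rightarrow> (nat \<Rightarrow> complex) set" where
  "ray_jets \<sigma> l = {c. \<exists>G. jet_family \<sigma> l G \<and> c = (\<lambda>j. G j 0)}"

lemma jet_family_has_vector_derivative:
  assumes "jet_family \<sigma> l G" "t \<in> {0..1/l}"
  shows "(G j has_vector_derivative G (Suc j) t) (at t within {0..1/l})"
  unfolding has_vector_derivative_def has_derivative_within_alt
proof (intro conjI allI impI bounded_linear_scaleR_left)
  fix e :: real assume e: "e > 0"
  define B where "B = \<bar>l * wgt \<sigma> l (j + 2)\<bar> + 1"
  have B: "B > 0" by (simp add: B_def)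
  show "\<exists>d>0. \<forall>y\<in>{0..1/l}. norm (y - t) < d \<longrightarrow>
      norm (G j y - G j t - (y - t) *\<^sub>R G (Suc j) t) \<le> e * norm (y - t)"
  proof (intro exI[of _ "e / B"] conjI ballI impI)
    fix y assume y: "y \<in> {0..1/l}" "norm (y - t) < e / B"
    have "norm (G j y - G j t - (y - t) *\<^sub>R G (Suc j) t) \<le> l * wgt \<sigma> l (j + 2) * (y - t)\<^sup>2"
      using assms y by (auto simp: jet_family_def)
    also have "\<dots> \<le> B * (y - t)\<^sup>2" by (intro mult_right_mono) (auto simp: B_def)
    also have "\<dots> = (B * \<bar>y - t\<bar>) * \<bar>y - t\<bar>" by (simp add: power2_eq_square)
    also have "\<dots> \<le> e * \<bar>y - t\<bar>"
      using y(2) B by (intro mult_right_mono) (auto simp: field_simps)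
    finally show "norm (G j y - G j t - (y - t) *\<^sub>R G (Suc j) t) \<le> e * norm (y - t)" by simp
  qed (use e B in auto)
qed

text \<open>Two applications of the mean value inequality: the bound on order j + 2 makes
  \<open>G (Suc j)\<close> Lipschitz, and this controls the derivative of x \<mapsto> G j x - x G
  (Suc j) s on the segment from s to t.\<close>

lemma jet_familyI:
  assumes l: "l > 0"
    and bd: "\<And>j t. t \<in> {0..1/l} \<Longrightarrow> norm (G j t) \<le> l * wgt \<sigma> l j"
    and der: "\<And>j t. t \<in> {0..1/l} \<Longrightarrow> (G j has_vector_derivative G (Suc j) t) (at t within {0..1/l})"
  shows "jet_family \<sigma> l G"
  unfolding jet_family_def
proof (intro conjI allI ballI bd)
  have lip: "norm (G j x - G j y) \<le> l * wgt \<sigma> l (Suc j) * \<bar>x - y\<bar>"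
    if "x \<in> {0..1/l}" "y \<in> {0..1/l}" for j x y
    unfolding real_norm_def[symmetric]
  proof (rule differentiable_bound[of "{0..1/l}" "G j" "\<lambda>t h. h *\<^sub>R G (Suc j) t"])
    fix t assume "t \<in> {0..1/l}"
    then show "onorm (\<lambda>h. h *\<^sub>R G (Suc j) t) \<le> l * wgt \<sigma> l (Suc j)"
      by (intro onorm_le) (auto simp: mult.commute bd intro!: mult_left_mono)
  qed (use der that in \<open>auto simp: has_vector_derivative_def\<close>)
  fix j s t assume st: "s \<in> {0..1/l}" "t \<in> {0..1/l}"
  have "norm ((G j t - t *\<^sub>R G (Suc j) s) - (G j s - s *\<^sub>R G (Suc j) s))
      \<le> (l * wgt \<sigma> l (j + 2) * \<bar>t - s\<bar>) * norm (t - s)"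
  proof (rule differentiable_bound[of "closed_segment s t" "\<lambda>x. G j x - x *\<^sub>R G (Suc j) s"
        "\<lambda>x h. h *\<^sub>R (G (Suc j) x - G (Suc j) s)"])
    fix x assume x: "x \<in> closed_segment s t"
    then have xs: "\<bar>x - s\<bar> \<le> \<bar>t - s\<bar>" "x \<in> {0..1/l}" and sub: "closed_segment s t \<subseteq> {0..1/l}"
      using st by (auto simp: closed_segment_eq_real_ivl split: if_splits)
    have "((\<lambda>x. G j x - x *\<^sub>R G (Suc j) s) has_vector_derivative (G (Suc j) x - 1 *\<^sub>R G (Suc j) s))
        (at x within closed_segment s t)"
      by (intro derivative_intros has_vector_derivative_within_subset[OF der sub] xs)
        (auto intro!: derivative_eq_intros)
    then show "((\<lambda>x. G j x - x *\<^sub>R G (Suc j) s) has_derivative (\<lambda>h. h *\<^sub>R (G (Suc j) x - G (Suc j) s)))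
        (at x within closed_segment s t)"
      by (simp add: has_vector_derivative_def)
    have "norm (G (Suc j) x - G (Suc j) s) \<le> l * wgt \<sigma> l (j + 2) * \<bar>x - s\<bar>"
      using lip[OF xs(2) st(1), of "Suc j"] by simp
    also have "\<dots> \<le> l * wgt \<sigma> l (j + 2) * \<bar>t - s\<bar>"
      using xs l less_imp_le[OF wgt_pos] by (intro mult_left_mono) auto
    finally show "onorm (\<lambda>h. h *\<^sub>R (G (Suc j) x - G (Suc j) s)) \<le> l * wgt \<sigma> l (j + 2) * \<bar>t - s\<bar>"
      by (intro onorm_le) (auto simp: mult.commute intro!: mult_left_mono)
  qed auto
  moreover have "(G j t - t *\<^sub>R G (Suc j) s) - (G j s - s *\<^sub>R G (Suc j) s)
      = G j t - G j s - (t - s) *\<^sub>R G (Suc j) s"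
    by (simp add: scaleR_diff_left)
  moreover have "\<bar>t - s\<bar> * norm (t - s) = (t - s)\<^sup>2"
    by (simp add: power2_eq_square)
  ultimately show "norm (G j t - G j s - (t - s) *\<^sub>R G (Suc j) s) \<le> l * wgt \<sigma> l (j + 2) * (t - s)\<^sup>2"
    by (simp only: mult.assoc)
qed

lemma jet_family_mono:
  assumes "W_class \<sigma>" "0 < l" "l \<le> l'" "jet_family \<sigma> l G"
  shows "jet_family \<sigma> l' G"
proof -
  have le: "l * wgt \<sigma> l j \<le> l' * wgt \<sigma> l' j" for j
    using assms wgt_mono[OF assms(1-3)] less_imp_le[OF wgt_pos[of \<sigma> l j]] by (intro mult_mono) auto
  have sub: "t \<in> {0..1/l}" if "t \<in> {0..1/l'}" for t
    using that assms frac_le[of 1 1 l l'] by auto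
  show ?thesis
    unfolding jet_family_def
  proof (intro conjI allI ballI)
    fix j t assume "t \<in> {0..1/l'}"
    then have "norm (G j t) \<le> l * wgt \<sigma> l j"
      using assms(4) sub by (simp add: jet_family_def)
    then show "norm (G j t) \<le> l' * wgt \<sigma> l' j" using le order_trans by blast
  next
    fix j s t assume "s \<in> {0..1/l'}" "t \<in> {0..1/l'}"
    then have "norm (G j t - G j s - (t - s) *\<^sub>R G (Suc j) s) \<le> l * wgt \<sigma> l (j + 2) * (t - s)\<^sup>2"
      using assms(4) sub by (simp add: jet_family_def)
    also have "\<dots> \<le> l' * wgt \<sigma> l' (j + 2) * (t - s)\<^sup>2"
      by (intro mult_right_mono le) auto
    finally show "norm (G j t - G j s - (t - s) *\<^sub>R G (Suc j) s) \<le> l' * wgt \<sigma> l' (j + 2) * (t - s)\<^sup>2" .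
  qed
qed

lemma ray_jets_mono:
  assumes "W_class \<sigma>" "0 < l" "l \<le> l'"
  shows "ray_jets \<sigma> l \<subseteq> ray_jets \<sigma> l'"
  using jet_family_mono[OF assms] by (auto simp: ray_jets_def)

lemma ray_jets_add:
  assumes \<sigma>: "W_class \<sigma>" and l: "0 < l" "0 < l'" and c: "c \<in> ray_jets \<sigma> l" "c' \<in> ray_jets \<sigma> l'"
  shows "(\<lambda>j. c j + c' j) \<in> ray_jets \<sigma> (2 * (l + l'))"
proof -
  obtain G G' where G: "jet_family \<sigma> l G" "c = (\<lambda>j. G j 0)" and G': "jet_family \<sigma> l' G'" "c' = (\<lambda>j. G' j 0)"
    using c by (auto simp: ray_jets_def)
  define L where "L = l + l'"
  have L: "L > 0" "L \<le> 2 * L" using l by (auto simp: L_def)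
  have GL: "jet_family \<sigma> L G" "jet_family \<sigma> L G'"
    using jet_family_mono[OF \<sigma> _ _ G(1), of L] jet_family_mono[OF \<sigma> _ _ G'(1), of L] l
    by (auto simp: L_def)
  have sub: "{0..1/(2 * L)} \<subseteq> {0..1/L}"
    using L by (auto simp: field_simps)
  \<comment> \<open>Doubling the parameter absorbs the two summands, each bounded by
    \<open>L * wgt \<sigma> L j\<close>.\<close>
  have "jet_family \<sigma> (2 * L) (\<lambda>j t. G j t + G' j t)"
  proof (rule jet_familyI)
    fix j t assume t: "t \<in> {0..1/(2 * L)}"
    then have t': "t \<in> {0..1/L}" using sub by blast
    have "norm (G j t + G' j t) \<le> L * wgt \<sigma> L j + L * wgt \<sigma> L j"
      using GL t' by (intro norm_triangle_le add_mono) (auto simp: jet_family_def)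
    also have "\<dots> \<le> 2 * L * wgt \<sigma> (2 * L) j"
      using L wgt_mono[OF \<sigma> L, of j] by simp
    finally show "norm (G j t + G' j t) \<le> 2 * L * wgt \<sigma> (2 * L) j" .
    show "((\<lambda>t. G j t + G' j t) has_vector_derivative G (Suc j) t + G' (Suc j) t)
        (at t within {0..1/(2 * L)})"
      by (intro derivative_intros has_vector_derivative_within_subset[OF _ sub]
          jet_family_has_vector_derivative[where \<sigma> = \<sigma>] GL t')
  qed (use L in auto)
  then show ?thesis using G(2) G'(2) by (auto simp: ray_jets_def L_def)
qed

lemma ray_jets_cmult:
  assumes \<sigma>: "W_class \<sigma>" and l: "0 < l" and c: "c \<in> ray_jets \<sigma> l"
  shows "(\<lambda>j. z * c j) \<in> ray_jets \<sigma> ((norm z + 1) * l)"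
proof -
  obtain G where G: "jet_family \<sigma> l G" "c = (\<lambda>j. G j 0)"
    using c by (auto simp: ray_jets_def)
  \<comment> \<open>The summand 1 keeps the new parameter at least l when z is small.\<close>
  define L where "L = (norm z + 1) * l"
  have L: "L > 0" "l \<le> L" using l by (auto simp: L_def algebra_simps add_pos_nonneg)
  have sub: "{0..1/L} \<subseteq> {0..1/l}"
    using L l frac_le[of 1 1 l L] by auto
  have "jet_family \<sigma> L (\<lambda>j t. z * G j t)"
  proof (rule jet_familyI)
    fix j t assume t: "t \<in> {0..1/L}"
    then have t': "t \<in> {0..1/l}" using sub by blast
    have "norm (z * G j t) \<le> (norm z + 1) * (l * wgt \<sigma> l j)"
      using G(1) t' unfolding norm_mult by (intro mult_mono) (auto simp: jet_family_def)
    also have "\<dots> \<le> L * wgt \<sigma> L j"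
      using L wgt_mono[OF \<sigma> l L(2), of j] unfolding L_def mult.assoc[symmetric]
      by (intro mult_left_mono) auto
    finally show "norm (z * G j t) \<le> L * wgt \<sigma> L j" .
    show "((\<lambda>t. z * G j t) has_vector_derivative z * G (Suc j) t) (at t within {0..1/L})"
      by (intro derivative_intros has_vector_derivative_within_subset[OF _ sub]
          jet_family_has_vector_derivative[where \<sigma> = \<sigma>] G t')
  qed (use L in auto)
  then show ?thesis using G(2) by (auto simp: ray_jets_def L_def)
qed

section \<open>Gap series\<close>

text \<open>The derivatives of all orders j of the polynomial are written with the same range of
  summation, so that they form one family indexed by j; the surplus terms vanish by the hypothesis
  on p.\<close>

lemma taylor_family:
  fixes p :: "nat \<Rightarrow> complex"
  assumes "\<And>j. j > D \<Longrightarrow> p j = 0"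
  shows "((\<lambda>t. \<Sum>i\<le>D. p (j + i) * complex_of_real (t ^ i / fact i)) has_vector_derivative
     (\<Sum>i\<le>D. p (Suc j + i) * complex_of_real (t ^ i / fact i))) (at t within S)"
proof -
  define q where "q = (\<lambda>i. if i = 0 then 0 else p (j + i) * complex_of_real (t ^ (i - 1) / fact (i - 1)))"
  have "((\<lambda>t. p (j + i) * complex_of_real (t ^ i / fact i)) has_vector_derivative q i) (at t within S)" for i
  proof (cases i)
    case (Suc m)
    have "((\<lambda>t. t ^ i / fact i) has_real_derivative t ^ m / fact m) (at t within S)"
      unfolding Suc using DERIV_cdivide[OF DERIV_pow[of "Suc m" t S], of "fact (Suc m)"]
      by (simp del: of_nat_Suc)
    then have "((\<lambda>t. complex_of_real (t ^ i / fact i)) has_vector_derivative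
        complex_of_real (t ^ m / fact m)) (at t within S)"
      by (intro has_vector_derivative_of_real)
        (simp add: has_real_derivative_iff_has_vector_derivative)
    from has_vector_derivative_mult_right[OF this, of "p (j + i)"] show ?thesis
      by (simp add: q_def Suc)
  qed (simp add: q_def)
  then have "((\<lambda>t. \<Sum>i\<le>D. p (j + i) * complex_of_real (t ^ i / fact i)) has_vector_derivative
      (\<Sum>i\<le>D. q i)) (at t within S)"
    by (intro has_vector_derivative_sum)
  also have "(\<Sum>i\<le>D. q i) = (\<Sum>i\<le>Suc D. q i)"
    using assms by (simp add: q_def)
  also have "\<dots> = (\<Sum>i\<le>D. q (Suc i))"
    by (subst sum.atMost_Suc_shift) (simp add: q_def)
  finally show ?thesis by (simp add: q_def)
qed

text \<open>\<open>high_order_zero_imp_small\<close> is applied to G minus the polynomial, whose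
  derivatives of order below N vanish at 0. The difference obeys bounds of the same type because all
  weights are at least 1 and, as l >= 1, all points of the interval are at most 1.\<close>

lemma jet_family_close_to_taylor:
  assumes \<sigma>: "W_class \<sigma>" "quasianalytic \<sigma>" and l: "l \<ge> 1" and B: "B \<ge> 0"
  shows "\<exists>N. \<forall>G p. jet_family \<sigma> l G \<and> (\<forall>j. norm (p j) \<le> B) \<and> (\<forall>j>D. p j = 0) \<and> (\<forall>j<N. G j 0 = p j)
    \<longrightarrow> (\<forall>t\<in>{0..1/l}. norm (G 0 t - (\<Sum>i\<le>D. p i * complex_of_real (t ^ i / fact i))) \<le> 1)"
proof -
  have l0: "l > 0" using l by simp
  \<comment> \<open>Each of the D + 1 terms of the polynomial is at most B on [0, 1].\<close>
  define R where "R = l + (D + 1) * B"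
  have R: "R > 0" using l0 B by (auto simp: R_def intro!: add_pos_nonneg)
  obtain N where N: "\<And>G :: nat \<Rightarrow> real \<Rightarrow> complex.
    \<lbrakk>\<forall>j. \<forall>t\<in>{0..1/l}. (G j has_vector_derivative G (Suc j) t) (at t within {0..1/l});
     \<forall>j. \<forall>t\<in>{0..1/l}. norm (G j t) \<le> R * wgt \<sigma> l j; \<forall>j<N. G j 0 = 0\<rbrakk> \<Longrightarrow>
     \<forall>t\<in>{0..1/l}. norm (G 0 t) \<le> 1"
    using high_order_zero_imp_small[OF wgt_pos wgt_ratio_mono[OF \<sigma>(1) l0]
        quasianalytic_not_summable[OF \<sigma> l0] R, of 1 "1/l"] by (metis zero_less_one)
  show ?thesis
  proof (intro exI[of _ N] allI impI, elim conjE)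
    fix G p
    assume G: "jet_family \<sigma> l G" and pB: "\<forall>j. norm (p j) \<le> B" and p0: "\<forall>j>D. p j = 0"
      and eq: "\<forall>j<N. G j 0 = p j"
    define P where "P = (\<lambda>j t. \<Sum>i\<le>D. p (j + i) * complex_of_real (t ^ i / fact i))"
    have dP: "(P j has_vector_derivative P (Suc j) t) (at t within S)" for j t S
      unfolding P_def using p0 by (intro taylor_family) auto
    have "\<forall>t\<in>{0..1/l}. norm (G 0 t - P 0 t) \<le> 1"
    proof (rule N[of "\<lambda>j t. G j t - P j t"]; intro allI ballI impI)
      fix j t assume t: "t \<in> {0..1/l}"
      show "((\<lambda>t. G j t - P j t) has_vector_derivative G (Suc j) t - P (Suc j) t) (at t within {0..1/l})"
        by (intro derivative_intros dP jet_family_has_vector_derivative[OF G t])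
      have "1 / l \<le> 1" using l by simp
      then have t1: "0 \<le> t" "t \<le> 1" using t by auto
      have "norm (P j t) \<le> (\<Sum>i\<le>D. B)"
        unfolding P_def
      proof (rule sum_norm_le)
        fix i
        have "t ^ i / fact i \<le> 1 / 1"
          using t1 by (intro frac_le power_le_one) (auto simp: fact_ge_1)
        then have "norm (p (j + i)) * (t ^ i / fact i) \<le> B * 1"
          using pB B t1 by (intro mult_mono) auto
        then show "norm (p (j + i) * complex_of_real (t ^ i / fact i)) \<le> B"
          using t1 by (simp add: norm_mult norm_power norm_divide)
      qed
      also have "\<dots> = (D + 1) * B * 1" by simp
      also have "\<dots> \<le> (D + 1) * B * wgt \<sigma> l j"
        using B wgt_ge_1[OF \<sigma>(1) l0] by (intro mult_left_mono) auto
      finally have "norm (P j t) \<le> (D + 1) * B * wgt \<sigma> l j" .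
      moreover have "norm (G j t) \<le> l * wgt \<sigma> l j" using G t by (auto simp: jet_family_def)
      ultimately show "norm (G j t - P j t) \<le> R * wgt \<sigma> l j"
        using norm_triangle_ineq4[of "G j t" "P j t"] by (simp add: R_def algebra_simps)
    next
      fix j assume "j < N"
      moreover have "P j 0 = p j"
        unfolding P_def by (subst sum.remove[of _ 0]) (auto simp: power_0_left)
      ultimately show "G j 0 - P j 0 = 0" using eq by simp
    qed
    then show "\<forall>t\<in>{0..1/l}. norm (G 0 t - (\<Sum>i\<le>D. p i * complex_of_real (t ^ i / fact i))) \<le> 1"
      by (simp add: P_def)
  qed
qed

text \<open>A power series with these derivatives at 0 has radius of convergence 0. Arbitrarily
  large orders j are asked for instead of all large ones: this is what a liminf condition on
  \<omega> yields, and a gap series may choose its exponents among them.\<close>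

definition superanalytic :: "(nat \<Rightarrow> real) \<Rightarrow> bool" where
  "superanalytic u \<longleftrightarrow> (\<forall>j. u j > 0) \<and> (\<forall>A m. \<exists>j\<ge>m. A ^ j * fact j \<le> u j)"

text \<open>Two consecutive Taylor polynomials of a gap series both approximate the quasianalytic
  function up to 1, hence the one monomial by which they differ is bounded by 2 on \<open>[0, 1/l]\<close>.\<close>

proposition gap_sequence:
  assumes \<sigma>: "W_class \<sigma>" "quasianalytic \<sigma>" and u: "superanalytic u"
  shows "\<exists>J::nat \<Rightarrow> nat. strict_mono J \<and> (\<forall>l>0. \<forall>K. \<forall>\<kappa>>0. \<forall>d\<in>ray_jets \<sigma> l.
    (\<forall>j. norm (d j) \<le> K * u j) \<longrightarrow> (\<forall>j. j \<notin> range J \<longrightarrow> d j = 0) \<longrightarrow>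
    (\<exists>i. \<forall>i'\<ge>i. norm (d (J i')) < \<kappa> * u (J i')))"
proof -
  have u0: "u j > 0" for j using u by (simp add: superanalytic_def)
  define U where "U = (\<lambda>m. \<Sum>j\<le>m. u j)"
  have U: "u j \<le> U m" if "j \<le> m" for j m
    unfolding U_def using that less_imp_le[OF u0] by (intro member_le_sum) auto
  have U0: "U m \<ge> 0" for m unfolding U_def using less_imp_le[OF u0] by (intro sum_nonneg)
  \<comment> \<open>The index i gives both the class parameter and the factor in the coefficient
    bound. For given l and K every i with \<open>Suc i\<close> above both is admissible, so one
    sequence J handles all functions.\<close>
  define close where "close = (\<lambda>i D N. \<forall>G p. jet_family \<sigma> (real (Suc i)) G \<and>
      (\<forall>j. norm (p j) \<le> real (Suc i) * U D) \<and> (\<forall>j>D. p j = 0) \<and> (\<forall>j<N. G j 0 = p j)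
    \<longrightarrow> (\<forall>t\<in>{0..1/real (Suc i)}. norm (G 0 t - (\<Sum>i\<le>D. p i * complex_of_real (t ^ i / fact i))) \<le> 1))"
  \<comment> \<open>Of the 2 j powers of \<open>Suc i\<close>, j compensate for the evaluation at t
    = 1 / Suc i, and the other j exceed 2 / \<kappa> for large i.\<close>
  define big where "big = (\<lambda>i j. real (Suc i) ^ (2 * j) * fact j \<le> u j)"
  have exbig: "\<exists>j\<ge>m. big i j" for i m
    using u by (simp add: superanalytic_def big_def power_mult)
  \<comment> \<open>A sequence supported on \<open>range J\<close> agrees with its truncation at J i
    in all orders below J (Suc i). Hence J (Suc i) is taken at least as large as the N that belongs
    to the degree J i.\<close>
  have "\<exists>J. \<forall>i. big i (J i) \<and> (J i < J (Suc i) \<and> close i (J i) (J (Suc i)))"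
  proof (rule dependent_nat_choice)
    show "\<exists>j. big 0 j" using exbig by blast
    fix D i
    obtain N where N: "close i D N"
      unfolding close_def
      using jet_family_close_to_taylor[OF \<sigma>, of "real (Suc i)" "real (Suc i) * U D" D] U0[of D] by auto
    obtain j where "j \<ge> max N (Suc D)" "big (Suc i) j" using exbig by blast
    moreover from this N have "close i D j" unfolding close_def by auto
    ultimately show "\<exists>y. big (Suc i) y \<and> (D < y \<and> close i D y)" by auto
  qed
  then obtain J where J: "\<And>i. big i (J i)" "\<And>i. J i < J (Suc i)" "\<And>i. close i (J i) (J (Suc i))"
    by blast
  have mono: "strict_mono J" using J(2) by (simp add: strict_mono_Suc_iff)
  show ?thesis
  proof (intro exI[of _ J] conjI mono allI impI ballI)
    fix l K \<kappa> d
    assume l: "(l::real) > 0" and \<kappa>: "(\<kappa>::real) > 0" and d: "d \<in> ray_jets \<sigma> l"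
      and dK: "\<forall>j. norm (d j) \<le> K * u j" and d0: "\<forall>j. j \<notin> range J \<longrightarrow> d j = 0"
    obtain G where G: "jet_family \<sigma> l G" "d = (\<lambda>j. G j 0)" using d by (auto simp: ray_jets_def)
    have approx: "norm (G 0 t - (\<Sum>j\<le>J i. d j * complex_of_real (t ^ j / fact j))) \<le> 1"
      if i: "real (Suc i) \<ge> l" "real (Suc i) \<ge> K" and t: "t \<in> {0..1 / real (Suc i)}" for i t
    proof -
      define p where "p = (\<lambda>j. if j \<le> J i then d j else 0)"
      have gap: "j \<notin> range J" if "J i < j" "j < J (Suc i)" for j
        using that mono by (auto simp: strict_mono_less)
      have "norm (p j) \<le> real (Suc i) * U (J i)" for j
      proof (cases "j \<le> J i")
        case True
        have "norm (d j) \<le> K * u j" using dK by blast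
        also have "\<dots> \<le> real (Suc i) * U (J i)"
          using i(2) U[OF True] u0[of j] by (intro mult_mono) auto
        finally show ?thesis using True by (simp add: p_def)
      next
        case False
        then show ?thesis using U0 by (simp add: p_def)
      qed
      moreover have "G j 0 = p j" if "j < J (Suc i)" for j
        using d0 gap that G(2) by (cases "j \<le> J i") (auto simp: p_def fun_eq_iff)
      moreover have "jet_family \<sigma> (real (Suc i)) G"
        by (rule jet_family_mono[OF \<sigma>(1) l i(1) G(1)])
      moreover have "\<forall>j>J i. p j = 0" by (simp add: p_def)
      ultimately have "norm (G 0 t - (\<Sum>j\<le>J i. p j * complex_of_real (t ^ j / fact j))) \<le> 1"
        using J(3)[of i] t unfolding close_def by blast
      then show ?thesis by (simp add: p_def)
    qed
    obtain n :: nat where n: "real n \<ge> max (max l K) (2 / \<kappa> + 1)"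
      using real_arch_simple by blast
    show "\<exists>i. \<forall>i'\<ge>i. norm (d (J i')) < \<kappa> * u (J i')"
    proof (intro exI[of _ "Suc n"] allI impI)
      fix i' assume "i' \<ge> Suc n"
      then obtain i where i: "i' = Suc i" "n \<le> i" by (cases i') auto
      \<comment> \<open>The right end of the smaller of the two intervals: both approximations are
        available there, and the monomial is largest.\<close>
      define t where "t = 1 / real (Suc i')"
      have t: "t \<in> {0..1 / real (Suc i')}" "t \<in> {0..1 / real (Suc i)}" "t > 0"
        using i by (auto simp: t_def intro!: frac_le)
      define g where "g = (\<lambda>j. d j * complex_of_real (t ^ j / fact j))"
      have gap0: "sum g {J i<..<J i'} = 0"
      proof (rule sum.neutral, intro ballI)
        fix j assume "j \<in> {J i<..<J i'}"
        then have "j \<notin> range J" using mono i by (auto simp: strict_mono_less)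
        then show "g j = 0" using d0 by (simp add: g_def)
      qed
      have "{..J i'} = insert (J i') ({..J i} \<union> {J i<..<J i'})"
        using J(2)[of i] i by auto
      then have "sum g {..J i'} = g (J i') + sum g ({..J i} \<union> {J i<..<J i'})"
        using J(2)[of i] i by simp
      also have "sum g ({..J i} \<union> {J i<..<J i'}) = sum g {..J i} + sum g {J i<..<J i'}"
        by (intro sum.union_disjoint) auto
      finally have split: "(\<Sum>j\<le>J i'. d j * complex_of_real (t ^ j / fact j)) =
          d (J i') * complex_of_real (t ^ J i' / fact (J i')) + (\<Sum>j\<le>J i. d j * complex_of_real (t ^ j / fact j))"
        using gap0 by (simp add: g_def)
      have "norm (d (J i') * complex_of_real (t ^ J i' / fact (J i'))) \<le> 1 + 1"
      proof -
        have "l \<le> real (Suc i)" "K \<le> real (Suc i)" "l \<le> real (Suc i')" "K \<le> real (Suc i')"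
          using n i by auto
        note approx[OF this(1,2) t(2)] approx[OF this(3,4) t(1)]
        then have "norm ((G 0 t - (\<Sum>j\<le>J i. d j * complex_of_real (t ^ j / fact j)))
           - (G 0 t - (\<Sum>j\<le>J i'. d j * complex_of_real (t ^ j / fact j)))) \<le> 1 + 1"
          by (rule order_trans[OF norm_triangle_ineq4 add_mono])
        then show ?thesis unfolding split by simp
      qed
      then have "norm (d (J i')) * (t ^ J i' / fact (J i')) \<le> 2"
        using t(3) by (simp add: norm_mult norm_power norm_divide)
      then have le: "norm (d (J i')) \<le> 2 * real (Suc i') ^ J i' * fact (J i')"
        by (simp add: t_def field_simps power_divide)
      have "J i' \<ge> 1" using J(2)[of i] i by simp
      have "2 < \<kappa> * real (Suc i')"
      proof -
        have "2 / \<kappa> < real (Suc i')" using n i by simp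
        then show ?thesis using \<kappa> by (simp add: field_simps)
      qed
      also have "\<dots> \<le> \<kappa> * real (Suc i') ^ J i'"
        using \<open>J i' \<ge> 1\<close> \<kappa> self_le_power[of "real (Suc i')" "J i'"] by (intro mult_left_mono) auto
      finally have "2 * (real (Suc i') ^ J i' * fact (J i'))
          < \<kappa> * real (Suc i') ^ J i' * (real (Suc i') ^ J i' * fact (J i'))"
        by (intro mult_strict_right_mono) auto
      also have "\<dots> = \<kappa> * (real (Suc i') ^ (2 * J i') * fact (J i'))"
        by (simp only: mult_2 power_add mult.assoc)
      also have "\<dots> \<le> \<kappa> * u (J i')"
        using J(1)[of i'] \<kappa> unfolding big_def by (intro mult_left_mono) auto
      finally show "norm (d (J i')) < \<kappa> * u (J i')" using le by (simp add: mult.assoc)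
    qed
  qed
qed

section \<open>Closedness of the set of jets\<close>

text \<open>Tychonoff's theorem for a product of closed discs; it will be applied with the
  uncountable index set \<open>nat \<times> real\<close>.\<close>

lemma compact_norm_le_fun:
  fixes B :: "'i \<Rightarrow> real"
  shows "compact {f :: 'i \<Rightarrow> complex. \<forall>i. norm (f i) \<le> B i}"
proof -
  have "{f :: 'i \<Rightarrow> complex. \<forall>i. norm (f i) \<le> B i} = (\<Pi>\<^sub>E i\<in>UNIV. cball 0 (B i))"
    by (auto simp: PiE_iff)
  moreover have "compactin (product_topology (\<lambda>i::'i. euclidean) UNIV) (\<Pi>\<^sub>E i\<in>UNIV. cball (0::complex) (B i))"
    by (simp add: compactin_PiE)
  ultimately show ?thesis by (simp add: euclidean_product_topology)
qed

lemma compact_fun_imp_closed: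
  fixes S :: "('i \<Rightarrow> 'b::metric_space) set"
  assumes "compact S"
  shows "closed S"
proof -
  have "Hausdorff_space (product_topology (\<lambda>i::'i. euclidean :: 'b topology) UNIV)"
    by (simp add: Hausdorff_space_product_topology)
  then have "Hausdorff_space (euclidean :: ('i \<Rightarrow> 'b) topology)"
    by (simp add: euclidean_product_topology)
  then show ?thesis
    using compactin_imp_closedin[of euclidean S] assms by simp
qed

text \<open>A family is regarded as a point of the product over all pairs (order, point). Each
  remainder estimate involves at most three coordinates, hence is closed, and the bounds place the
  families in a product of discs; the jets are the image under evaluation at 0.\<close>

lemma closed_ray_jets:
  assumes l: "l > 0"
  shows "closed (ray_jets \<sigma> l)"
proof -
  \<comment> \<open>The bound is imposed at every real point so that X is a full product; a family
    is extended by 0 outside its interval.\<close>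
  define X :: "(nat \<times> real \<Rightarrow> complex) set" where
    "X = {H. \<forall>i. norm (H i) \<le> l * wgt \<sigma> l (fst i)}"
  define Y :: "(nat \<times> real \<Rightarrow> complex) set" where
    "Y = {H. \<forall>j. \<forall>s\<in>{0..1/l}. \<forall>t\<in>{0..1/l}.
        norm (H (j, t) - H (j, s) - (t - s) *\<^sub>R H (Suc j, s)) \<le> l * wgt \<sigma> l (j + 2) * (t - s)\<^sup>2}"
  have "closed Y"
    unfolding Y_def Ball_def
    by (intro closed_Collect_all closed_Collect_imp closed_Collect_le continuous_intros
        continuous_on_product_coordinates open_Collect_const)
  moreover have "compact X" unfolding X_def by (rule compact_norm_le_fun)
  ultimately have "compact (X \<inter> Y)" by (intro compact_Int_closed)
  moreover have "continuous_on (X \<inter> Y) (\<lambda>H j. H (j, 0::real))"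
    by (intro continuous_on_coordinatewise_then_product)
      (rule continuous_on_subset[OF continuous_on_product_coordinates], simp)
  ultimately have "compact ((\<lambda>H j. H (j, 0)) ` (X \<inter> Y))"
    by (intro compact_continuous_image)
  moreover have "ray_jets \<sigma> l = (\<lambda>H j. H (j, 0)) ` (X \<inter> Y)"
  proof (intro equalityI subsetI)
    fix c assume "c \<in> ray_jets \<sigma> l"
    then obtain G where G: "jet_family \<sigma> l G" "c = (\<lambda>j. G j 0)" by (auto simp: ray_jets_def)
    define H where "H = (\<lambda>(j, t). if t \<in> {0..1/l} then G j t else 0)"
    have "H \<in> X" using G l less_imp_le[OF wgt_pos] by (auto simp: X_def H_def jet_family_def)
    moreover have "H \<in> Y" using G by (auto simp: Y_def H_def jet_family_def)
    moreover have "c = (\<lambda>j. H (j, 0))" using G l by (simp add: H_def)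
    ultimately show "c \<in> (\<lambda>H j. H (j, 0)) ` (X \<inter> Y)" by blast
  next
    fix c assume "c \<in> (\<lambda>H j. H (j, 0)) ` (X \<inter> Y)"
    then obtain H where H: "H \<in> X" "H \<in> Y" "c = (\<lambda>j. H (j, 0))" by blast
    have "jet_family \<sigma> l (\<lambda>j t. H (j, t))"
      using H(1,2) by (auto simp: jet_family_def X_def Y_def)
    then show "c \<in> ray_jets \<sigma> l" using H(3) by (auto simp: ray_jets_def)
  qed
  ultimately show ?thesis using compact_fun_imp_closed by metis
qed

section \<open>Restriction to an axis\<close>

text \<open>Jets are tested on one coordinate axis only (\<open>undefined\<close> is an arbitrary fixed coordinate).
  A multi-index on the axis is realised by a single list of directions, hence the value of
  \<open>pderiv_alpha\<close> there does not depend on the symmetry of mixed derivatives.\<close>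

definition ray_index :: "nat \<Rightarrow> 'n::finite \<Rightarrow> nat" where
  "ray_index k = (\<lambda>i. if i = undefined then k else 0)"

text \<open>The factor \<open>fact k\<close> undoes the normalisation in \<open>jet\<close>: the ray
  of a jet is the sequence of pure derivatives along the axis.\<close>

definition ray :: "(('n::finite \<Rightarrow> nat) \<Rightarrow> complex) \<Rightarrow> nat \<Rightarrow> complex" where
  "ray b = (\<lambda>k. fact k * b (ray_index k))"

definition of_ray :: "(nat \<Rightarrow> complex) \<Rightarrow> ('n::finite \<Rightarrow> nat) \<Rightarrow> complex" where
  "of_ray c = (\<lambda>\<alpha>. if \<alpha> = ray_index (mlen \<alpha>) then c (mlen \<alpha>) / fact (mlen \<alpha>) else 0)"

text \<open>Coordinates off the axis are unrestricted: each set in the union is the preimage under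
  \<open>ray\<close> of a compact set, and its closedness is what is used.\<close>

definition ray_quasianalytic :: "(real \<Rightarrow> real) \<Rightarrow> (('n::finite \<Rightarrow> nat) \<Rightarrow> complex) set" where
  "ray_quasianalytic \<sigma> = (\<Union>n::nat. {b. ray b \<in> ray_jets \<sigma> (real (Suc n))})"

lemma mlen_ray_index [simp]: "mlen (ray_index k :: 'n::finite \<Rightarrow> nat) = k"
  by (simp add: mlen_def ray_index_def)

lemma ray_of_ray [simp]: "ray (of_ray c :: ('n::finite \<Rightarrow> nat) \<Rightarrow> complex) = c"
  by (auto simp: ray_def of_ray_def fun_eq_iff)

section \<open>Linear structure of the enlarged set of jets\<close>

lemma ray_quasianalyticI:
  assumes "W_class \<sigma>" "l > 0" "ray b \<in> ray_jets \<sigma> l"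
  shows "b \<in> ray_quasianalytic \<sigma>"
proof -
  obtain n where "l \<le> real n" using real_arch_simple by blast
  then have "ray b \<in> ray_jets \<sigma> (real (Suc n))"
    using ray_jets_mono[OF assms(1,2), of "real (Suc n)"] assms(3) by auto
  then show ?thesis by (auto simp: ray_quasianalytic_def)
qed

lemma ray_quasianalyticE:
  assumes "b \<in> ray_quasianalytic \<sigma>"
  obtains l where "l > 0" "ray b \<in> ray_jets \<sigma> l"
  using assms by (auto simp: ray_quasianalytic_def intro: that[of "real (Suc _)"])

lemma ray_quasianalytic_sadd:
  assumes "W_class \<sigma>" "a \<in> ray_quasianalytic \<sigma>" "b \<in> ray_quasianalytic \<sigma>"
  shows "sadd a b \<in> ray_quasianalytic \<sigma>"
proof -
  obtain l l' where l: "l > 0" "ray a \<in> ray_jets \<sigma> l" "l' > 0" "ray b \<in> ray_jets \<sigma> l'"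
    using assms(2,3) by (metis ray_quasianalyticE)
  have "ray (sadd a b) = (\<lambda>k. ray a k + ray b k)"
    by (simp add: ray_def sadd_def algebra_simps)
  then show ?thesis
    using ray_jets_add[OF assms(1) l(1,3,2,4)] l by (intro ray_quasianalyticI[of _ "2 * (l + l')"] assms) auto
qed

lemma ray_quasianalytic_sscale:
  assumes "W_class \<sigma>" "a \<in> ray_quasianalytic \<sigma>"
  shows "sscale z a \<in> ray_quasianalytic \<sigma>"
proof -
  obtain l where l: "l > 0" "ray a \<in> ray_jets \<sigma> l"
    using assms(2) by (metis ray_quasianalyticE)
  have "ray (sscale z a) = (\<lambda>k. z * ray a k)"
    by (simp add: ray_def sscale_def algebra_simps)
  then show ?thesis
    using ray_jets_cmult[OF assms(1) l, of z] l
    by (intro ray_quasianalyticI[of _ "(norm z + 1) * l"] assms) (auto intro!: mult_pos_pos add_nonneg_pos)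
qed

lemma closed_ray_preimage:
  assumes "l > 0"
  shows "closed {b. ray b \<in> ray_jets \<sigma> l}"
proof -
  have "continuous_on UNIV (ray :: (('n::finite \<Rightarrow> nat) \<Rightarrow> complex) \<Rightarrow> _)"
    unfolding ray_def
    by (intro continuous_on_coordinatewise_then_product continuous_intros continuous_on_product_coordinates)
  from closed_vimage[OF closed_ray_jets[OF assms] this] show ?thesis
    by (simp add: vimage_def)
qed

lemma count_list_ray_index:
  "(\<forall>i. count_list xs i = ray_index k i) \<longleftrightarrow> xs = replicate k (undefined :: 'n::finite)"
proof
  assume *: "\<forall>i. count_list xs i = ray_index k i"
  have "i = undefined" if "i \<in> set xs" for i
  proof (rule ccontr)
    assume "i \<noteq> undefined"
    then have "count_list xs i = 0" using * by (simp add: ray_index_def)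
    then show False using that by (simp add: count_list_0_iff)
  qed
  then have xs: "replicate (length xs) undefined = xs" by (intro replicate_length_same) auto
  have "count_list (replicate n (undefined :: 'n)) undefined = n" for n
    by (induction n) auto
  then have "count_list xs undefined = length xs" by (metis xs)
  then show "xs = replicate k undefined" using * xs by (auto simp: ray_index_def)
next
  assume "xs = replicate k undefined"
  moreover have "count_list (replicate n (undefined :: 'n)) i = ray_index n i" for n i
    by (induction n) (auto simp: ray_index_def)
  ultimately show "\<forall>i. count_list xs i = ray_index k i" by blast
qed

lemma pderiv_alpha_ray_index:
  "pderiv_alpha (ray_index k) f = iter_partial (replicate k undefined) f"
  by (simp add: pderiv_alpha_def count_list_ray_index)

text \<open>On a compact segment from 0 along the axis, inside the cube, one l and one C bound all
  derivatives; a single larger parameter L then absorbs l, C and the length of the segment.\<close>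

lemma jet_germs_subset_ray_quasianalytic:
  assumes \<sigma>: "W_class \<sigma>"
  shows "jet_germs_roumieu \<sigma> \<subseteq> (ray_quasianalytic \<sigma> :: (('n::finite \<Rightarrow> nat) \<Rightarrow> complex) set)"
proof
  fix b :: "('n \<Rightarrow> nat) \<Rightarrow> complex"
  assume "b \<in> jet_germs_roumieu \<sigma>"
  then obtain f k where b: "b = jet f" and k: "k \<ge> (1::nat)" and f: "f \<in> E_roumieu \<sigma> (cube k)"
    by (auto simp: jet_germs_roumieu_def)
  define e :: "real ^ 'n" where "e = axis undefined 1"
  define a where "a = 1 / (2 * real k)"
  have a: "a > 0" "a < 1 / real k" using k by (auto simp: a_def field_simps)
  define F where "F = (\<lambda>j. iter_partial (replicate j undefined) f)"
  define G where "G = (\<lambda>j t. F j (t *\<^sub>R e))"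
  have in_cube: "t *\<^sub>R e \<in> cube k" if "t \<in> {0..a}" for t
    using that a by (auto simp: cube_def e_def axis_def)
  define K where "K = (\<lambda>t. t *\<^sub>R e) ` {0..a}"
  have "compact K" unfolding K_def by (intro compact_continuous_image continuous_intros) auto
  moreover have "K \<subseteq> cube k" unfolding K_def using in_cube by auto
  ultimately obtain l where l: "l > 0" "bdd_on \<sigma> K l f"
    using f by (auto simp: E_roumieu_def)
  then obtain C where C: "\<And>\<alpha> x. x \<in> K \<Longrightarrow> norm (pderiv_alpha \<alpha> f x) \<le> C * wgt \<sigma> l (mlen \<alpha>)"
    by (auto simp: bdd_on_def)
  define L where "L = max (max (2 * real k) l) C"
  have L: "L > 0" "l \<le> L" "C \<le> L" "1 / L \<le> a"
    using l k by (auto simp: L_def a_def intro!: frac_le)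
  have "jet_family \<sigma> L G"
  proof (rule jet_familyI[OF L(1)])
    fix j t assume "t \<in> {0..1/L}"
    then have t: "t \<in> {0..a}" using L by auto
    then have "t *\<^sub>R e \<in> K" unfolding K_def by (rule imageI)
    then have "norm (G j t) \<le> C * wgt \<sigma> l j"
      using C[of "t *\<^sub>R e" "ray_index j"] by (simp add: G_def F_def pderiv_alpha_ray_index)
    also have "\<dots> \<le> L * wgt \<sigma> L j"
      using L l wgt_mono[OF \<sigma> l(1) L(2)] less_imp_le[OF wgt_pos[of \<sigma> l j]] by (intro mult_mono) auto
    finally show "norm (G j t) \<le> L * wgt \<sigma> L j" .
    \<comment> \<open>\<open>partial_i\<close> differentiates along a translated line at parameter
      0; composing with the shift s - t turns this into a derivative of \<open>G j\<close> at
      t.\<close>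
    have "(\<lambda>s. F j (t *\<^sub>R e + s *\<^sub>R e)) differentiable (at 0)"
      using f in_cube[OF t] by (auto simp: E_roumieu_def smooth_on_def F_def e_def)
    then have "((\<lambda>s. F j (t *\<^sub>R e + s *\<^sub>R e)) has_vector_derivative
        vector_derivative (\<lambda>s. F j (t *\<^sub>R e + s *\<^sub>R e)) (at 0)) (at 0)"
      by (simp add: vector_derivative_works)
    also have "vector_derivative (\<lambda>s. F j (t *\<^sub>R e + s *\<^sub>R e)) (at 0) = G (Suc j) t"
      by (simp add: G_def F_def partial_i_def e_def)
    also have "(\<lambda>s. F j (t *\<^sub>R e + s *\<^sub>R e)) = (\<lambda>s. G j (t + s))"
      by (simp add: G_def scaleR_add_left)
    finally have "((\<lambda>s. G j (t + s)) has_vector_derivative G (Suc j) t) (at (t - t))" by simp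
    then have "((\<lambda>s. G j (t + s)) \<circ> (\<lambda>s. s - t) has_vector_derivative 1 *\<^sub>R G (Suc j) t) (at t)"
      by (intro vector_diff_chain_at) (auto intro!: derivative_eq_intros)
    then show "(G j has_vector_derivative G (Suc j) t) (at t within {0..1/L})"
      by (simp add: o_def has_vector_derivative_at_within)
  qed
  moreover have "ray b = (\<lambda>j. G j 0)"
    by (simp add: ray_def b jet_def pderiv_alpha_ray_index G_def F_def fun_eq_iff)
  ultimately show "b \<in> ray_quasianalytic \<sigma>"
    using L(1) by (intro ray_quasianalyticI[OF \<sigma>]) (auto simp: ray_jets_def)
qed

lemma jet_germs_beurling_subset_roumieu:
  "jet_germs_beurling \<sigma> \<subseteq> jet_germs_roumieu \<sigma>"
proof -
  have "E_beurling \<sigma> U \<subseteq> E_roumieu \<sigma> U" for U :: "(real ^ 'a) set"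
    unfolding E_beurling_def E_roumieu_def by (auto intro!: exI[of _ 1])
  then show ?thesis unfolding jet_germs_beurling_def jet_germs_roumieu_def by fast
qed

section \<open>Sequences of superanalytic growth\<close>

text \<open>At a large t with \<tau>(t) <= \<epsilon> t, the order j = floor (\<epsilon> t) works:
  t^j is at least (j / \<epsilon>)^j and e^-\<tau>(t) at least e^-(j+1), and with 1 / \<epsilon> =
  A' e^2 the product exceeds A^j j!.\<close>

lemma superanalyticI:
  assumes u: "\<And>j t. t \<ge> 1 \<Longrightarrow> t ^ j * exp (- \<tau> t) \<le> u j"
    and \<tau>: "\<And>\<epsilon>. \<epsilon> > 0 \<Longrightarrow> \<exists>\<^sub>F t in at_top. \<tau> t \<le> \<epsilon> * t"
  shows "superanalytic u"
  unfolding superanalytic_def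
proof (intro conjI allI)
  fix j show "u j > 0" using u[of 1 j] by (auto intro: less_le_trans[OF exp_gt_zero])
next
  fix A :: real and m :: nat
  define A' where "A' = max 1 \<bar>A\<bar>"
  have A': "A' \<ge> 1" by (simp add: A'_def)
  \<comment> \<open>Of the two factors e per order, one pays for exp (- (j + 1)) up to a constant,
    and the other leaves exp (j - 1) >= 1.\<close>
  define \<epsilon> where "\<epsilon> = 1 / (A' * exp 2)"
  have \<epsilon>: "\<epsilon> > 0" using A' by (simp add: \<epsilon>_def)
  have "\<exists>\<^sub>F t in at_top. \<tau> t \<le> \<epsilon> * t \<and> t \<ge> max 1 ((m + 1) / \<epsilon>)"
    using \<tau>[OF \<epsilon>] eventually_ge_at_top by (rule frequently_eventually_frequently)
  then obtain t where t: "\<tau> t \<le> \<epsilon> * t" "t \<ge> 1" "t \<ge> (m + 1) / \<epsilon>"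
    by (auto dest!: frequently_ex)
  then have mt: "real (m + 1) \<le> \<epsilon> * t" using \<epsilon> by (simp add: field_simps)
  define j where "j = nat \<lfloor>\<epsilon> * t\<rfloor>"
  have j: "real j \<le> \<epsilon> * t" "\<epsilon> * t \<le> real j + 1" "j \<ge> m" "j \<ge> 1"
    using mt unfolding j_def by linarith+
  have "A ^ j \<le> A' ^ j"
  proof -
    have "A ^ j \<le> \<bar>A\<bar> ^ j" by (metis abs_ge_self power_abs)
    also have "\<dots> \<le> A' ^ j" by (intro power_mono) (auto simp: A'_def)
    finally show ?thesis .
  qed
  moreover have "fact j \<le> real j ^ j"
    using fact_le_power[of j, where 'a = real] by simp
  ultimately have "A ^ j * fact j \<le> A' ^ j * real j ^ j"
    using A' by (intro mult_mono) auto
  also have "\<dots> \<le> A' ^ j * real j ^ j * exp (real j - 1)"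
    using mult_left_mono[of 1 "exp (real j - 1)" "A' ^ j * real j ^ j"] j A' by simp
  also have "\<dots> = (real j / \<epsilon>) ^ j * exp (- (real j + 1))"
  proof -
    have "(real j / \<epsilon>) ^ j = A' ^ j * real j ^ j * exp (2 * real j)"
      by (simp add: \<epsilon>_def power_mult_distrib mult_ac flip: exp_of_nat_mult)
    moreover have "exp (real j - 1) = exp (2 * real j) * exp (- (real j + 1))"
      by (simp flip: exp_add)
    ultimately show ?thesis by simp
  qed
  also have "\<dots> \<le> t ^ j * exp (- \<tau> t)"
    using j t \<epsilon> by (intro mult_mono power_mono) (auto simp: field_simps)
  also have "\<dots> \<le> u j" using u t by blast
  finally show "\<exists>j\<ge>m. A ^ j * fact j \<le> u j" using j by blast
qed

lemma superanalytic_wgt: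
  assumes \<omega>: "W_class \<omega>" and liminf: "Liminf at_top (\<lambda>t. ereal (\<omega> t / t)) = 0"
  shows "superanalytic (wgt \<omega> 1)"
proof (rule superanalyticI)
  fix j and t :: real assume "t \<ge> 1"
  then show "t ^ j * exp (- \<omega> t) \<le> wgt \<omega> 1 j"
    using power_le_wgt[OF \<omega>, of 1 t j] by simp
next
  fix \<epsilon> :: real assume \<epsilon>: "\<epsilon> > 0"
  show "\<exists>\<^sub>F t in at_top. \<omega> t \<le> \<epsilon> * t"
  proof (rule ccontr)
    assume "\<not> ?thesis"
    then have "\<forall>\<^sub>F t in at_top. \<omega> t > \<epsilon> * t" by (simp add: not_frequently not_le)
    then have "\<forall>\<^sub>F t in at_top. ereal \<epsilon> \<le> ereal (\<omega> t / t)"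
      using eventually_gt_at_top[of 0] by eventually_elim (simp add: field_simps)
    then have "ereal \<epsilon> \<le> Liminf at_top (\<lambda>t. ereal (\<omega> t / t))" by (rule Liminf_bounded)
    then show False using liminf \<epsilon> by simp
  qed
qed

text \<open>The geometric mean \<open>sqrt (t \<omega>(t))\<close> separates \<open>\<omega>(t)\<close> from \<open>t\<close>: it is \<open>o(t)\<close>, but still
  dominates every multiple of \<open>\<omega>\<close>.\<close>

lemma superanalytic_beurling:
  assumes \<omega>: "W_class \<omega>" and o: "\<omega> \<in> o[at_top](\<lambda>t. t)"
  shows "\<exists>u. superanalytic u \<and> (\<forall>l>0. \<exists>C. \<forall>j. u j \<le> C * wgt \<omega> l j)"
proof -
  define \<tau> where "\<tau> = (\<lambda>t. sqrt (t * \<omega> t))"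
  \<comment> \<open>The moment formula for \<open>wgt\<close> with parameter 1, applied to
    \<tau>.\<close>
  define u where "u = (\<lambda>j. Sup ((\<lambda>t. t ^ j * exp (- \<tau> t)) ` {1..}))"
  have small: "\<forall>\<^sub>F t in at_top. \<omega> t \<le> \<epsilon> * t" if "\<epsilon> > 0" for \<epsilon>
    using landau_o.smallD[OF o that] eventually_ge_at_top[of 0]
    by eventually_elim (auto simp: W_class_nonneg[OF \<omega>])
  have bound: "\<exists>C>0. \<forall>t\<ge>1. exp (- \<tau> t) \<le> C * exp (- (\<omega> t / l))" if l: "l > 0" for l
  proof -
    \<comment> \<open>The constant l^2 is what \<omega>(t) / l <= \<tau>(t) amounts to after
      squaring.\<close>
    obtain T where T: "\<And>t. t \<ge> T \<Longrightarrow> \<omega> t \<le> l\<^sup>2 * t"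
      using small[of "l\<^sup>2"] l unfolding eventually_at_top_linorder by auto
    define T' where "T' = max 1 T"
    have "exp (- \<tau> t) \<le> exp (\<omega> T' / l) * exp (- (\<omega> t / l))" if t: "t \<ge> 1" for t
    proof -
      have "\<omega> t / l \<le> \<tau> t + \<omega> T' / l"
      proof (cases "t \<le> T'")
        case True
        then have "\<omega> t / l \<le> \<omega> T' / l"
          using t l by (intro divide_right_mono W_class_mono[OF \<omega>]) auto
        moreover have "\<tau> t \<ge> 0" using t W_class_nonneg[OF \<omega>, of t] by (simp add: \<tau>_def)
        ultimately show ?thesis by simp
      next
        case False
        then have "\<omega> t * \<omega> t \<le> (l\<^sup>2 * t) * \<omega> t"
          using t W_class_nonneg[OF \<omega>, of t] by (intro mult_right_mono T) (auto simp: T'_def)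
        then have "(\<omega> t / l)\<^sup>2 \<le> t * \<omega> t"
          using l by (simp add: power2_eq_square field_simps)
        then have "\<omega> t / l \<le> \<tau> t" unfolding \<tau>_def by (rule real_le_rsqrt)
        moreover have "\<omega> T' / l \<ge> 0" using l W_class_nonneg[OF \<omega>, of T'] by (simp add: T'_def)
        ultimately show ?thesis by simp
      qed
      then show ?thesis by (simp flip: exp_add)
    qed
    then show ?thesis by (intro exI[of _ "exp (\<omega> T' / l)"]) auto
  qed
  have le: "\<exists>C. \<forall>j. \<forall>t\<ge>1. t ^ j * exp (- \<tau> t) \<le> C * wgt \<omega> l j" if l: "l > 0" for l
  proof -
    obtain C where C: "C > 0" "\<And>t. t \<ge> 1 \<Longrightarrow> exp (- \<tau> t) \<le> C * exp (- (\<omega> t / l))"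
      using bound[OF l] by auto
    have "t ^ j * exp (- \<tau> t) \<le> C * wgt \<omega> l j" if t: "t \<ge> 1" for t j
    proof -
      have "t ^ j * exp (- \<tau> t) \<le> t ^ j * (C * exp (- (\<omega> t / l)))"
        using C(2) t by (intro mult_left_mono) auto
      also have "\<dots> = C * (t ^ j * exp (- (\<omega> t / l)))" by simp
      also have "\<dots> \<le> C * wgt \<omega> l j"
        using C(1) t l \<omega> by (intro mult_left_mono power_le_wgt) auto
      finally show ?thesis .
    qed
    then show ?thesis by blast
  qed
  have "superanalytic u"
  proof (rule superanalyticI[where \<tau> = \<tau>])
    fix j and t :: real assume t: "t \<ge> 1"
    obtain C where "\<forall>j. \<forall>t\<ge>1. t ^ j * exp (- \<tau> t) \<le> C * wgt \<omega> 1 j" using le[of 1] by auto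
    then have "bdd_above ((\<lambda>t. t ^ j * exp (- \<tau> t)) ` {1..})"
      by (auto intro!: bdd_aboveI2)
    then show "t ^ j * exp (- \<tau> t) \<le> u j"
      unfolding u_def using t by (intro cSup_upper) auto
  next
    fix \<epsilon> :: real assume \<epsilon>: "\<epsilon> > 0"
    have "\<forall>\<^sub>F t in at_top. \<tau> t \<le> \<epsilon> * t"
      using small[OF zero_less_power[OF \<epsilon>, of 2]] eventually_ge_at_top[of 0]
    proof eventually_elim
      case (elim t)
      then have "t * \<omega> t \<le> (\<epsilon> * t)\<^sup>2"
        using \<epsilon> mult_left_mono[of "\<omega> t" "\<epsilon>\<^sup>2 * t" t] by (simp add: power2_eq_square mult_ac)
      then show ?case unfolding \<tau>_def using \<epsilon> elim by (intro real_le_lsqrt) auto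
    qed
    then show "\<exists>\<^sub>F t in at_top. \<tau> t \<le> \<epsilon> * t"
      by (rule eventually_frequently[rotated]) simp
  qed
  moreover have "\<exists>C. \<forall>j. u j \<le> C * wgt \<omega> l j" if "l > 0" for l
    unfolding u_def using le[OF that] by (auto intro!: cSup_least)
  ultimately show ?thesis by blast
qed

text \<open>The pairing function splits the exponents J into infinitely many infinite blocks, and c
  m scales u on block m. If c m is nonzero, the sequence has size norm (c m) * u at infinitely many
  exponents, contradicting \<open>gap_sequence\<close> with \<kappa> = norm (c m).\<close>

proposition lineable_ray:
  fixes L :: "(('n::finite \<Rightarrow> nat) \<Rightarrow> complex) set"
  assumes \<sigma>: "W_class \<sigma>" "quasianalytic \<sigma>" and u: "superanalytic u"
    and L: "\<And>K c. (\<And>j. norm (c j) \<le> K * u j) \<Longrightarrow> of_ray c \<in> L"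
  shows "lineable (L - ray_quasianalytic \<sigma>)"
proof -
  have u0: "u j > 0" for j using u by (simp add: superanalytic_def)
  obtain J :: "nat \<Rightarrow> nat" where J: "strict_mono J" and gap: "\<And>l K \<kappa> d. \<lbrakk>l > 0; \<kappa> > 0; d \<in> ray_jets \<sigma> l;
    \<And>j. norm (d j) \<le> K * u j; \<And>j. j \<notin> range J \<Longrightarrow> d j = 0\<rbrakk> \<Longrightarrow>
    \<exists>i. \<forall>i'\<ge>i. norm (d (J i')) < \<kappa> * u (J i')"
    using gap_sequence[OF \<sigma> u] by metis
  define e :: "(nat \<Rightarrow> complex) \<Rightarrow> nat \<Rightarrow> complex" where
    "e = (\<lambda>c j. if j \<in> range J then c (fst (prod_decode (inv J j))) * complex_of_real (u j) else 0)"
  have eJ: "e c (J (prod_encode (m, i))) = c m * complex_of_real (u (J (prod_encode (m, i))))" for c m i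
    using strict_mono_imp_inj_on[OF J] by (simp add: e_def)
  have e_bound: "norm (e c j) \<le> K * u j" if "\<And>m. norm (c m) \<le> K" for c K j
  proof -
    have "K \<ge> 0" using that[of 0] norm_ge_zero[of "c 0"] by linarith
    then show ?thesis
      using that less_imp_le[OF u0] by (auto simp: e_def norm_mult intro!: mult_right_mono)
  qed
  define V :: "(('n \<Rightarrow> nat) \<Rightarrow> complex) set" where
    "V = {of_ray (e c) | c. \<exists>K. \<forall>m. norm (c m) \<le> K}"
  have VI: "of_ray (e c) \<in> V" if "\<And>m. norm (c m) \<le> K" for c K
    unfolding V_def using that by blast
  have zero: "of_ray (e (\<lambda>_. 0)) = (\<lambda>_ :: 'n \<Rightarrow> nat. 0)"
    by (auto simp: of_ray_def e_def fun_eq_iff)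
  show ?thesis
    unfolding lineable_def
  proof (intro exI[of _ V] conjI ballI allI)
    show "V \<subseteq> (L - ray_quasianalytic \<sigma>) \<union> {\<lambda>_. 0}"
    proof
      fix b assume "b \<in> V"
      then obtain c K where b: "b = of_ray (e c)" and K: "\<And>m. norm (c m) \<le> K"
        by (auto simp: V_def)
      show "b \<in> (L - ray_quasianalytic \<sigma>) \<union> {\<lambda>_. 0}"
      proof (cases "c = (\<lambda>_. 0)")
        case True
        then show ?thesis using b zero by simp
      next
        case False
        then obtain m where m: "c m \<noteq> 0" by auto
        have "b \<notin> ray_quasianalytic \<sigma>"
        proof
          assume "b \<in> ray_quasianalytic \<sigma>"
          then obtain l where l: "l > 0" "e c \<in> ray_jets \<sigma> l"
            unfolding b by (metis ray_quasianalyticE ray_of_ray)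
          obtain i where i: "\<forall>i'\<ge>i. norm (e c (J i')) < norm (c m) * u (J i')"
            using gap[OF l(1) _ l(2) e_bound[OF K], of "norm (c m)"] m by (auto simp: e_def)
          \<comment> \<open>\<open>prod_encode (m, i)\<close> is at least i, so this member of block
            m lies beyond the threshold.\<close>
          have "norm (e c (J (prod_encode (m, i)))) < norm (c m) * u (J (prod_encode (m, i)))"
            using i le_prod_encode_2 by blast
          then show False using less_imp_le[OF u0] by (simp add: eJ norm_mult)
        qed
        moreover have "b \<in> L" unfolding b by (rule L[OF e_bound[OF K]])
        ultimately show ?thesis by simp
      qed
    qed
    show "(\<lambda>_. 0) \<in> V" using VI[of "\<lambda>_. 0" 0] zero by simp
    fix a assume "a \<in> V"
    then obtain c K where a: "a = of_ray (e c)" and K: "\<And>m. norm (c m) \<le> K" by (auto simp: V_def)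
    {
      fix b assume "b \<in> V"
      then obtain c' K' where b: "b = of_ray (e c')" and K': "\<And>m. norm (c' m) \<le> K'" by (auto simp: V_def)
      have "sadd a b = of_ray (e (\<lambda>m. c m + c' m))"
        unfolding a b by (auto simp: sadd_def of_ray_def e_def fun_eq_iff algebra_simps add_divide_distrib)
      then show "sadd a b \<in> V"
        using VI[of "\<lambda>m. c m + c' m" "K + K'"] norm_triangle_mono[OF K K'] by simp
    }
    fix z
    have "sscale z a = of_ray (e (\<lambda>m. z * c m))"
      unfolding a by (auto simp: sscale_def of_ray_def e_def fun_eq_iff)
    then show "sscale z a \<in> V"
      using VI[of "\<lambda>m. z * c m" "norm z * K"] K by (simp add: norm_mult mult_left_mono)
  next
    fix n :: nat
    define v :: "nat \<Rightarrow> ('n \<Rightarrow> nat) \<Rightarrow> complex" where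
      "v = (\<lambda>i. of_ray (e (\<lambda>m. if m = i then 1 else 0)))"
    show "\<exists>v. (\<forall>i<n. v i \<in> V) \<and> (\<forall>c. (\<forall>\<alpha>. (\<Sum>i<n. c i * v i \<alpha>) = 0) \<longrightarrow> (\<forall>i<n. c i = 0))"
    proof (intro exI[of _ v] conjI allI impI)
      fix i show "v i \<in> V" unfolding v_def by (rule VI[of _ 1]) simp
    next
      fix c i assume c: "\<forall>\<alpha>. (\<Sum>i<n. c i * v i \<alpha>) = 0" and i: "i < n"
      \<comment> \<open>An exponent of block i, where all other v i' vanish, isolates the
        coefficient c i.\<close>
      define k where "k = J (prod_encode (i, 0))"
      have "0 = (\<Sum>i'<n. c i' * v i' (ray_index k))" using c by simp
      also have "\<dots> = (\<Sum>i'<n. if i' = i then c i * (complex_of_real (u k) / fact k) else 0)"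
        unfolding v_def of_ray_def k_def by (intro sum.cong) (auto simp: eJ)
      also have "\<dots> = c i * (complex_of_real (u k) / fact k)" using i by simp
      finally show "c i = 0" using u0[of k] by simp
    qed
  qed
qed

section \<open>Smallness of proper subspaces\<close>

lemma lineable_mono: "lineable S \<Longrightarrow> S \<subseteq> T \<Longrightarrow> lineable T"
  unfolding lineable_def
  by (erule exE, rule exI, erule conjE, rule conjI, erule order_trans, blast, assumption)

text \<open>A single independent vector is nonzero, so lineability of the complement of a subspace
  shows in particular that the subspace is proper.\<close>

lemma lineable_nonempty:
  assumes "lineable (S :: (('n::finite \<Rightarrow> nat) \<Rightarrow> complex) set)"
  obtains v where "v \<in> S"
proof -
  obtain V where V: "V \<subseteq> S \<union> {(\<lambda>_. 0)}"
    and ex: "\<And>n. \<exists>v :: nat \<Rightarrow> ('n \<Rightarrow> nat) \<Rightarrow> complex. (\<forall>i<n. v i \<in> V) \<and>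
        (\<forall>c :: nat \<Rightarrow> complex. (\<forall>\<alpha>. (\<Sum>i<n. c i * v i \<alpha>) = 0) \<longrightarrow> (\<forall>i<n. c i = 0))"
    using assms unfolding lineable_def by blast
  obtain v where v: "\<forall>i<1. v i \<in> V"
    "\<forall>c :: nat \<Rightarrow> complex. (\<forall>\<alpha>. (\<Sum>i<1. c i * v i \<alpha>) = 0) \<longrightarrow> (\<forall>i<1. c i = 0)"
    using ex[of 1] by (elim exE conjE)
  have "v 0 \<in> V" using v(1) by simp
  moreover have "v 0 \<noteq> (\<lambda>_. 0)"
  proof
    assume "v 0 = (\<lambda>_. 0)"
    then show False using v(2)[rule_format, of "\<lambda>_. 1" 0] by simp
  qed
  ultimately show ?thesis using V that by blast
qed

section \<open>Seminorms of the sequence spaces and the topology of the Beurling space\<close>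

lemma seq_bdd_sadd:
  assumes "seq_bdd \<omega> l a" "seq_bdd \<omega> l b"
  shows "seq_bdd \<omega> l (sadd a b)"
proof -
  obtain C D where C: "\<And>\<alpha>. norm (a \<alpha>) * fact (mlen \<alpha>) \<le> C * wgt \<omega> l (mlen \<alpha>)"
    and D: "\<And>\<alpha>. norm (b \<alpha>) * fact (mlen \<alpha>) \<le> D * wgt \<omega> l (mlen \<alpha>)"
    using assms unfolding seq_bdd_def by blast
  have "norm (sadd a b \<alpha>) * fact (mlen \<alpha>) \<le> (C + D) * wgt \<omega> l (mlen \<alpha>)" for \<alpha>
  proof -
    have "norm (sadd a b \<alpha>) * fact (mlen \<alpha>) \<le> (norm (a \<alpha>) + norm (b \<alpha>)) * fact (mlen \<alpha>)"
      by (intro mult_right_mono) (auto simp: sadd_def norm_triangle_ineq)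
    then show ?thesis using C[of \<alpha>] D[of \<alpha>] by (simp add: algebra_simps)
  qed
  then show ?thesis unfolding seq_bdd_def by blast
qed

lemma sscale_bound:
  assumes "norm (a \<alpha>) * fact (mlen \<alpha>) \<le> C * wgt \<omega> l (mlen \<alpha>)"
  shows "norm (sscale z a \<alpha>) * fact (mlen \<alpha>) \<le> norm z * C * wgt \<omega> l (mlen \<alpha>)"
  using mult_left_mono[OF assms, of "norm z"] by (simp add: sscale_def norm_mult mult.assoc)

lemma seq_bdd_sscale: "seq_bdd \<omega> l a \<Longrightarrow> seq_bdd \<omega> l (sscale z a)"
  unfolding seq_bdd_def using sscale_bound by blast

lemma ssub_eq: "ssub a b = sadd a (sscale (- 1) b)"
  by (simp add: ssub_def sadd_def sscale_def)

lemma Lambda_beurling_sadd: "a \<in> Lambda_beurling \<omega> \<Longrightarrow> b \<in> Lambda_beurling \<omega> \<Longrightarrow> sadd a b \<in> Lambda_beurling \<omega>"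
  by (auto simp: Lambda_beurling_def intro: seq_bdd_sadd)

lemma Lambda_beurling_sscale: "a \<in> Lambda_beurling \<omega> \<Longrightarrow> sscale z a \<in> Lambda_beurling \<omega>"
  by (auto simp: Lambda_beurling_def intro: seq_bdd_sscale)

lemma Lambda_beurling_ssub: "a \<in> Lambda_beurling \<omega> \<Longrightarrow> b \<in> Lambda_beurling \<omega> \<Longrightarrow> ssub a b \<in> Lambda_beurling \<omega>"
  by (simp add: ssub_eq Lambda_beurling_sadd Lambda_beurling_sscale)

lemma snorm_le:
  assumes "\<And>\<alpha>. norm (b \<alpha>) * fact (mlen \<alpha>) \<le> C * wgt \<omega> l (mlen \<alpha>)"
  shows "snorm \<omega> l b \<le> C"
  unfolding snorm_def using assms wgt_pos by (intro cSUP_least) (auto simp: divide_le_eq)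

lemma norm_le_snorm:
  assumes "seq_bdd \<omega> l b"
  shows "norm (b \<alpha>) * fact (mlen \<alpha>) \<le> snorm \<omega> l b * wgt \<omega> l (mlen \<alpha>)"
proof -
  obtain C where "\<And>\<alpha>. norm (b \<alpha>) * fact (mlen \<alpha>) \<le> C * wgt \<omega> l (mlen \<alpha>)"
    using assms unfolding seq_bdd_def by blast
  then have "norm (b \<alpha>) * fact (mlen \<alpha>) / wgt \<omega> l (mlen \<alpha>) \<le> snorm \<omega> l b"
    unfolding snorm_def using wgt_pos[of \<omega> l]
    by (intro cSUP_upper bdd_aboveI2[where M = C]) (auto simp: divide_le_eq)
  then show ?thesis using wgt_pos[of \<omega> l] by (simp add: divide_le_eq)
qed

text \<open>The Frechet topology is finer than the product topology: a basic product neighbourhood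
  restricts finitely many coordinates, and the seminorm with l = 1 already controls each of
  them.\<close>

lemma open_beurling_Int_open:
  fixes P :: "(('n::finite \<Rightarrow> nat) \<Rightarrow> complex) set"
  assumes "open P"
  shows "open_beurling \<omega> (Lambda_beurling \<omega> \<inter> P)"
  unfolding open_beurling_def
proof (intro conjI ballI)
  fix a assume a: "a \<in> Lambda_beurling \<omega> \<inter> P"
  have "openin (product_topology (\<lambda>_. euclidean) UNIV) P"
    using assms by (simp add: euclidean_product_topology)
  then obtain X where X: "a \<in> Pi\<^sub>E UNIV X" "\<And>i. open (X i)" "finite {i. X i \<noteq> UNIV}" "Pi\<^sub>E UNIV X \<subseteq> P"
    using product_topology_open_contains_basis[of "\<lambda>_. euclidean" UNIV P a] a by auto
  define I where "I = {i. X i \<noteq> UNIV}"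
  have "\<exists>\<delta>>0. ball (a i) \<delta> \<subseteq> X i" for i
    using X(1,2) by (auto simp: PiE_iff open_contains_ball)
  then obtain \<delta> where \<delta>: "\<And>i. \<delta> i > 0" "\<And>i. ball (a i) (\<delta> i) \<subseteq> X i" by metis
  \<comment> \<open>The seminorm radius that forces coordinate i into the disc of radius
    \<open>\<delta> i\<close>; the 1 inserted below covers the case of no restricted
    coordinate.\<close>
  define q where "q = (\<lambda>i. \<delta> i * fact (mlen i) / wgt \<omega> 1 (mlen i))"
  define \<epsilon> where "\<epsilon> = Min (insert 1 (q ` I))"
  have I: "finite I" using X(3) by (simp add: I_def)
  have \<epsilon>: "\<epsilon> > 0" "\<And>i. i \<in> I \<Longrightarrow> \<epsilon> \<le> q i"
    using I \<delta>(1) wgt_pos by (auto simp: \<epsilon>_def q_def)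
  show "\<exists>L \<epsilon>. finite L \<and> L \<subseteq> {0<..} \<and> \<epsilon> > 0 \<and> (\<forall>b\<in>Lambda_beurling \<omega>.
      (\<forall>l\<in>L. snorm \<omega> l (ssub b a) < \<epsilon>) \<longrightarrow> b \<in> Lambda_beurling \<omega> \<inter> P)"
  proof (intro exI[of _ "{1}"] exI[of _ \<epsilon>] conjI ballI impI)
    fix b assume b: "b \<in> Lambda_beurling \<omega>" "\<forall>l\<in>{1}. snorm \<omega> l (ssub b a) < \<epsilon>"
    have bdd: "seq_bdd \<omega> 1 (ssub b a)"
      using Lambda_beurling_ssub[OF b(1)] a by (auto simp: Lambda_beurling_def)
    have "b i \<in> X i" for i
    proof (cases "i \<in> I")
      case True
      have "norm (b i - a i) * fact (mlen i) \<le> snorm \<omega> 1 (ssub b a) * wgt \<omega> 1 (mlen i)"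
        using norm_le_snorm[OF bdd, of i] by (simp add: ssub_def)
      also have "\<dots> < q i * wgt \<omega> 1 (mlen i)"
        using b(2) \<epsilon>(2)[OF True] wgt_pos by (intro mult_strict_right_mono) auto
      also have "\<dots> = \<delta> i * fact (mlen i)"
        using wgt_pos[of \<omega> 1 "mlen i"] by (simp add: q_def)
      finally have "norm (b i - a i) < \<delta> i" by simp
      then show ?thesis using \<delta>(2)[of i] by (auto simp: dist_norm norm_minus_commute)
    qed (auto simp: I_def)
    then have "b \<in> P" using X(4) by (auto simp: PiE_iff)
    then show "b \<in> Lambda_beurling \<omega> \<inter> P" using b(1) by simp
  qed (use \<epsilon> in auto)
qed simp

text \<open>Each seminorm of z v is at most |z| times a constant, and only finitely many seminorms
  occur in a basic neighbourhood.\<close>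

lemma open_beurling_line:
  assumes G: "open_beurling \<omega> G" "a \<in> G" and v: "v \<in> Lambda_beurling \<omega>"
  shows "\<exists>\<delta>>0. \<forall>z. norm z < \<delta> \<longrightarrow> sadd a (sscale z v) \<in> G"
proof -
  have "\<exists>L \<epsilon>. finite L \<and> L \<subseteq> {0<..} \<and> \<epsilon> > 0 \<and>
      (\<forall>b\<in>Lambda_beurling \<omega>. (\<forall>l\<in>L. snorm \<omega> l (ssub b a) < \<epsilon>) \<longrightarrow> b \<in> G)"
    using G(1)[unfolded open_beurling_def, THEN conjunct2, rule_format, OF G(2)] .
  then obtain L \<epsilon> where L: "finite L" "L \<subseteq> {0<..}" "\<epsilon> > 0"
    "\<forall>b\<in>Lambda_beurling \<omega>. (\<forall>l\<in>L. snorm \<omega> l (ssub b a) < \<epsilon>) \<longrightarrow> b \<in> G"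
    by (elim exE conjE)
  have "\<forall>l\<in>L. \<exists>C. \<forall>\<alpha>. norm (v \<alpha>) * fact (mlen \<alpha>) \<le> C * wgt \<omega> l (mlen \<alpha>)"
    using v L(2) unfolding Lambda_beurling_def seq_bdd_def by auto
  then obtain C where C: "\<And>l \<alpha>. l \<in> L \<Longrightarrow> norm (v \<alpha>) * fact (mlen \<alpha>) \<le> C l * wgt \<omega> l (mlen \<alpha>)"
    by metis
  \<comment> \<open>The 1 keeps D positive even if L is empty.\<close>
  define D where "D = Max (insert 1 (C ` L))"
  have D: "D > 0" "\<And>l. l \<in> L \<Longrightarrow> C l \<le> D"
    using L(1) by (auto simp: D_def less_le_trans[OF zero_less_one])
  show ?thesis
  proof (intro exI[of _ "\<epsilon> / D"] conjI allI impI)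
    fix z :: complex assume z: "norm z < \<epsilon> / D"
    show "sadd a (sscale z v) \<in> G"
    proof (rule L(4)[rule_format])
      show "sadd a (sscale z v) \<in> Lambda_beurling \<omega>"
        using G v by (intro Lambda_beurling_sadd Lambda_beurling_sscale) (auto simp: open_beurling_def)
      fix l assume l: "l \<in> L"
      have "ssub (sadd a (sscale z v)) a = sscale z v"
        by (simp add: ssub_def sadd_def)
      then have "snorm \<omega> l (ssub (sadd a (sscale z v)) a) \<le> norm z * C l"
        by (simp add: snorm_le sscale_bound C l)
      also have "\<dots> \<le> norm z * D" using D(2)[OF l] by (intro mult_left_mono) auto
      also have "\<dots> < \<epsilon>" using z D(1) by (simp add: field_simps)
      finally show "snorm \<omega> l (ssub (sadd a (sscale z v)) a) < \<epsilon>" .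
    qed
  qed (use D L in auto)
qed

lemma open_line_preimage:
  assumes G: "open_beurling \<omega> G" and v: "v \<in> Lambda_beurling \<omega>"
  shows "open {t::real. sscale (of_real t) v \<in> G}"
  unfolding open_dist
proof (intro ballI)
  fix t assume t: "t \<in> {t::real. sscale (of_real t) v \<in> G}"
  obtain \<delta> where \<delta>: "\<delta> > 0" "\<And>z. norm z < \<delta> \<Longrightarrow> sadd (sscale (of_real t) v) (sscale z v) \<in> G"
    using open_beurling_line[OF G _ v, of "sscale (of_real t) v"] t by auto
  have "sscale (of_real s) v \<in> G" if "dist s t < \<delta>" for s
  proof -
    have "sadd (sscale (of_real t) v) (sscale (of_real (s - t)) v) = sscale (of_real s) v"
      by (simp add: sadd_def sscale_def fun_eq_iff algebra_simps)
    moreover have "norm (of_real (s - t) :: complex) < \<delta>"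
      using that by (simp only: norm_of_real dist_real_def)
    ultimately show ?thesis using \<delta>(2)[of "of_real (s - t)"] by simp
  qed
  then show "\<exists>e>0. \<forall>s. dist s t < e \<longrightarrow> s \<in> {t. sscale (of_real t) v \<in> G}" using \<delta>(1) by auto
qed

lemma borel_beurling_Int_closed:
  assumes "closed P"
  shows "Lambda_beurling \<omega> \<inter> P \<in> borel_beurling \<omega>"
proof -
  have "Lambda_beurling \<omega> \<inter> - P \<in> borel_beurling \<omega>"
    unfolding borel_beurling_def using open_beurling_Int_open[OF open_Compl[OF assms]]
    by (intro sigma_sets.Basic) simp
  then have "Lambda_beurling \<omega> - (Lambda_beurling \<omega> \<inter> - P) \<in> borel_beurling \<omega>"
    unfolding borel_beurling_def by (rule sigma_sets.Compl)
  also have "Lambda_beurling \<omega> - (Lambda_beurling \<omega> \<inter> - P) = Lambda_beurling \<omega> \<inter> P" by auto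
  finally show ?thesis .
qed

lemma borel_beurling_Int_UN_closed:
  fixes P :: "nat \<Rightarrow> (('n::finite \<Rightarrow> nat) \<Rightarrow> complex) set"
  assumes "\<And>n. closed (P n)"
  shows "Lambda_beurling \<omega> \<inter> (\<Union>n. P n) \<in> borel_beurling \<omega>"
  using borel_beurling_Int_closed[OF assms, of \<omega>] unfolding borel_beurling_def Int_UN_distrib
  by (rule sigma_sets.Union)

text \<open>Only the union of the sets P n is a subspace. A nonempty open set inside one P n would
  contain a and a + z v with z nonzero, and their difference would put v into the union.\<close>

lemma meager_beurling_subspace:
  fixes P :: "nat \<Rightarrow> (('n::finite \<Rightarrow> nat) \<Rightarrow> complex) set"
  assumes P: "\<And>n. closed (P n)"
    and add: "\<And>a b. a \<in> (\<Union>n. P n) \<Longrightarrow> b \<in> (\<Union>n. P n) \<Longrightarrow> sadd a b \<in> (\<Union>n. P n)"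
    and scale: "\<And>a z. a \<in> (\<Union>n. P n) \<Longrightarrow> sscale z a \<in> (\<Union>n. P n)"
    and v: "v \<in> Lambda_beurling \<omega>" "v \<notin> (\<Union>n. P n)"
    and S: "S \<subseteq> (\<Union>n. P n)"
  shows "meager_beurling \<omega> S"
  unfolding meager_beurling_def
proof (intro exI[of _ "\<lambda>n. Lambda_beurling \<omega> \<inter> - P n"] conjI allI)
  fix n
  show "open_beurling \<omega> (Lambda_beurling \<omega> \<inter> - P n)"
    using P by (intro open_beurling_Int_open) auto
  show "dense_beurling \<omega> (Lambda_beurling \<omega> \<inter> - P n)"
    unfolding dense_beurling_def
  proof (intro allI impI, elim conjE)
    fix G :: "(('n \<Rightarrow> nat) \<Rightarrow> complex) set"
    assume G: "open_beurling \<omega> G" "G \<noteq> {}"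
    have sub: "G \<subseteq> Lambda_beurling \<omega>" using G(1) by (simp add: open_beurling_def)
    obtain a where a: "a \<in> G" using G(2) by blast
    obtain \<delta> where \<delta>: "\<delta> > 0" "\<And>z. norm z < \<delta> \<Longrightarrow> sadd a (sscale z v) \<in> G"
      using open_beurling_line[OF G(1) a v(1)] by blast
    define z where "z = complex_of_real (\<delta> / 2)"
    have z: "norm z < \<delta>" "z \<noteq> 0" using \<delta>(1) by (auto simp: z_def)
    show "G \<inter> (Lambda_beurling \<omega> \<inter> - P n) \<noteq> {}"
    proof (rule ccontr)
      assume "\<not> ?thesis"
      then have "G \<subseteq> P n" using sub by blast
      then have "a \<in> (\<Union>n. P n)" "sadd a (sscale z v) \<in> (\<Union>n. P n)" using a \<delta>(2)[OF z(1)] by auto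
      then have "sscale (1 / z) (sadd (sadd a (sscale z v)) (sscale (- 1) a)) \<in> (\<Union>n. P n)"
        by (intro scale[OF add[OF _ scale]])
      also have "sscale (1 / z) (sadd (sadd a (sscale z v)) (sscale (- 1) a)) = v"
        using z(2) by (simp add: sscale_def sadd_def)
      finally show False using v(2) by simp
    qed
  qed
next
  show "(\<Inter>n. Lambda_beurling \<omega> \<inter> - P n) \<subseteq> Lambda_beurling \<omega> - S" using S by auto
qed

text \<open>Apart from the one-point intersection with a line, the work is measurability: a
  translate of B is rewritten as a preimage under subtraction, which is again a countable union of
  closed sets.\<close>

lemma haar_null_beurling_subspace:
  fixes P :: "nat \<Rightarrow> (('n::finite \<Rightarrow> nat) \<Rightarrow> complex) set"
  assumes P: "\<And>n. closed (P n)"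
    and add: "\<And>a b. a \<in> (\<Union>n. P n) \<Longrightarrow> b \<in> (\<Union>n. P n) \<Longrightarrow> sadd a b \<in> (\<Union>n. P n)"
    and scale: "\<And>a z. a \<in> (\<Union>n. P n) \<Longrightarrow> sscale z a \<in> (\<Union>n. P n)"
    and v: "v \<in> Lambda_beurling \<omega>" "v \<notin> (\<Union>n. P n)"
    and S: "S \<subseteq> (\<Union>n. P n) \<inter> Lambda_beurling \<omega>"
  shows "haar_null_beurling \<omega> S"
proof -
  define \<Lambda> :: "(('n \<Rightarrow> nat) \<Rightarrow> complex) set" where "\<Lambda> = Lambda_beurling \<omega>"
  define N where "N = (\<Union>n. P n)"
  define line where "line = (\<lambda>t::real. sscale (of_real t) v)"
  define U where "U = uniform_measure lborel {0..1::real}"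
  define M where "M = distr U (sigma \<Lambda> {G. open_beurling \<omega> G}) line"
  define B where "B = \<Lambda> \<inter> N"
  define C where "C = line ` {0..1}"
  have gen: "{G. open_beurling \<omega> G} \<subseteq> Pow \<Lambda>" by (auto simp: open_beurling_def \<Lambda>_def)
  have line\<Lambda>: "line t \<in> \<Lambda>" for t using v by (simp add: line_def \<Lambda>_def Lambda_beurling_sscale)
  have meas: "line \<in> U \<rightarrow>\<^sub>M sigma \<Lambda> {G. open_beurling \<omega> G}"
  proof (rule measurable_measure_of[OF gen])
    fix G :: "(('n \<Rightarrow> nat) \<Rightarrow> complex) set"
    assume "G \<in> {G. open_beurling \<omega> G}"
    then have "open (line -` G)"
      using open_line_preimage[OF _ v(1), of G] by (simp add: line_def vimage_def)
    then show "line -` G \<inter> space U \<in> sets U" by (simp add: U_def)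
  qed (use line\<Lambda> in auto)
  have spaceM: "space M = \<Lambda>" and setsM: "sets M = borel_beurling \<omega>"
    using gen by (auto simp: M_def borel_beurling_def \<Lambda>_def space_measure_of sets_measure_of)
  have "prob_space U" unfolding U_def by (rule prob_space_uniform_measure) auto
  then have probM: "prob_space M" unfolding M_def by (rule prob_space.prob_space_distr[OF _ meas])
  have emM: "emeasure M A = emeasure lborel ({0..1} \<inter> line -` A)" if "A \<in> sets M" for A
  proof -
    have "line -` A \<inter> space U \<in> sets U"
      using that by (intro measurable_sets[OF meas]) (simp add: M_def)
    then have "line -` A \<in> sets lborel" by (simp add: U_def)
    moreover have "emeasure M A = emeasure U (line -` A)"
      using that unfolding M_def by (subst emeasure_distr[OF meas]) (auto simp: U_def)
    ultimately show ?thesis by (simp add: U_def divide_ennreal_def)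
  qed
  \<comment> \<open>C is Borel because it is compact, hence closed, for the product topology;
    compactness for the Frechet topology is shown separately below.\<close>
  have "continuous_on {0..1} line"
    unfolding line_def sscale_def
    by (intro continuous_on_coordinatewise_then_product continuous_intros)
  then have "closed C" unfolding C_def
    by (intro compact_fun_imp_closed compact_continuous_image) auto
  moreover have "\<Lambda> \<inter> C = C" using line\<Lambda> by (auto simp: C_def)
  ultimately have C_sets: "C \<in> sets M"
    using borel_beurling_Int_closed[of C \<omega>] by (simp add: setsM \<Lambda>_def)
  have "compact_beurling \<omega> C"
    unfolding compact_beurling_def
  proof (intro conjI allI impI, goal_cases)
    case 1
    show ?case using line\<Lambda> by (auto simp: C_def \<Lambda>_def)
  next
    case (2 \<U>)
    \<comment> \<open>A cover of C pulls back along \<open>line\<close> to an open cover of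
      [0, 1].\<close>
    obtain \<F> where "\<F> \<subseteq> \<U>" "finite \<F>" "{0..1} \<subseteq> (\<Union>G\<in>\<F>. line -` G)"
    proof (rule compactE_image[of "{0..1::real}" \<U> "\<lambda>G. line -` G"])
      fix G assume "G \<in> \<U>"
      then show "open (line -` G)"
        using 2 open_line_preimage[OF _ v(1), of G] by (simp add: line_def vimage_def)
    next
      show "{0..1} \<subseteq> (\<Union>G\<in>\<U>. line -` G)" using 2 unfolding C_def by blast
    qed auto
    then show ?case unfolding C_def by (intro exI[of _ \<F>]) blast
  qed
  moreover have "emeasure M C = 1"
  proof -
    have "{0..1} \<inter> line -` C = {0..1}" by (auto simp: C_def)
    then show ?thesis using emM[OF C_sets] by simp
  qed
  moreover have "B \<in> borel_beurling \<omega>"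
    unfolding B_def N_def \<Lambda>_def by (rule borel_beurling_Int_UN_closed[OF P])
  moreover have "sadd x ` B \<in> sets M \<and> emeasure M (sadd x ` B) = 0" if x: "x \<in> \<Lambda>" for x
  proof -
    have xB: "sadd x ` B = \<Lambda> \<inter> {b. ssub b x \<in> N}"
    proof (intro equalityI subsetI)
      fix b assume "b \<in> sadd x ` B"
      then obtain a where a: "a \<in> \<Lambda>" "a \<in> N" "b = sadd x a" by (auto simp: B_def)
      have "ssub b x = a" by (simp add: a ssub_def sadd_def)
      moreover have "b \<in> \<Lambda>" using a x by (simp add: \<Lambda>_def Lambda_beurling_sadd)
      ultimately show "b \<in> \<Lambda> \<inter> {b. ssub b x \<in> N}" using a by simp
    next
      fix b assume b: "b \<in> \<Lambda> \<inter> {b. ssub b x \<in> N}"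
      have "b = sadd x (ssub b x)" by (simp add: ssub_def sadd_def)
      moreover have "ssub b x \<in> B" using b x by (simp add: B_def \<Lambda>_def Lambda_beurling_ssub)
      ultimately show "b \<in> sadd x ` B" by blast
    qed
    have "closed {b. ssub b x \<in> P n}" for n
    proof -
      have "continuous_on UNIV (\<lambda>b. ssub b x)"
        unfolding ssub_def
        by (intro continuous_on_coordinatewise_then_product continuous_intros continuous_on_product_coordinates)
      from closed_vimage[OF P[of n] this] show ?thesis by (simp add: vimage_def)
    qed
    then have "\<Lambda> \<inter> (\<Union>n. {b. ssub b x \<in> P n}) \<in> borel_beurling \<omega>"
      unfolding \<Lambda>_def by (rule borel_beurling_Int_UN_closed)
    moreover have "(\<Union>n. {b. ssub b x \<in> P n}) = {b. ssub b x \<in> N}" by (auto simp: N_def)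
    ultimately have sets: "sadd x ` B \<in> sets M" by (simp add: xB setsM)
    have one: "s = t" if "line s \<in> sadd x ` B" "line t \<in> sadd x ` B" for s t
    proof (rule ccontr)
      assume "s \<noteq> t"
      then have z: "complex_of_real (s - t) \<noteq> 0" by simp
      have "sscale (1 / of_real (s - t)) (sadd (ssub (line s) x) (sscale (- 1) (ssub (line t) x))) \<in> N"
        using that unfolding xB N_def by (intro scale add) auto
      also have "sadd (ssub (line s) x) (sscale (- 1) (ssub (line t) x)) = sscale (of_real (s - t)) v"
        by (simp add: sadd_def sscale_def ssub_def line_def fun_eq_iff algebra_simps)
      also have "sscale (1 / of_real (s - t)) (sscale (of_real (s - t)) v) = v"
        using z by (simp add: sscale_def)
      finally show False using v(2) by (simp add: N_def)
    qed
    have "countable ({0..1} \<inter> line -` (sadd x ` B))"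
    proof (cases "line -` (sadd x ` B) = {}")
      case False
      then obtain t where "line t \<in> sadd x ` B" by blast
      then have "{0..1} \<inter> line -` (sadd x ` B) \<subseteq> {t}" using one by blast
      then show ?thesis by (rule countable_subset) simp
    qed simp
    then show ?thesis using sets emM[OF sets] by (simp add: emeasure_lborel_countable)
  qed
  moreover have "S \<subseteq> B" using S by (auto simp: B_def N_def \<Lambda>_def)
  ultimately show ?thesis
    unfolding haar_null_beurling_def
    using spaceM setsM probM C_sets by (intro exI[of _ B] exI[of _ M]) (auto simp: \<Lambda>_def)
qed

section \<open>Density in the inductive limit\<close>

lemma dense_roumieu_mono: "dense_roumieu \<omega> D \<Longrightarrow> D \<subseteq> D' \<Longrightarrow> dense_roumieu \<omega> D'"
  unfolding dense_roumieu_def by blast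

text \<open>The vector v lies in one step of the inductive limit, and the trace condition for that
  step puts a small multiple z v into the neighbourhood. Then a or a + z v lies outside N, since
  otherwise v would lie in N.\<close>

lemma dense_roumieu_subspace:
  fixes N :: "(('n::finite \<Rightarrow> nat) \<Rightarrow> complex) set"
  assumes add: "\<And>a b. a \<in> N \<Longrightarrow> b \<in> N \<Longrightarrow> sadd a b \<in> N"
    and scale: "\<And>a z. a \<in> N \<Longrightarrow> sscale z a \<in> N"
    and v: "v \<in> Lambda_roumieu \<omega>" "v \<notin> N"
  shows "dense_roumieu \<omega> (Lambda_roumieu \<omega> - N)"
  unfolding dense_roumieu_def
proof (intro allI impI, elim conjE)
  fix G :: "(('n \<Rightarrow> nat) \<Rightarrow> complex) set"
  assume G: "open_roumieu \<omega> G" "G \<noteq> {}"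
  have sub: "G \<subseteq> Lambda_roumieu \<omega>" using G(1) by (simp add: open_roumieu_def)
  obtain a where a: "a \<in> G" using G(2) by blast
  obtain W where W: "\<forall>l>0. \<exists>\<epsilon>>0. \<forall>b. seq_bdd \<omega> l b \<and> snorm \<omega> l b < \<epsilon> \<longrightarrow> b \<in> W"
    "\<forall>w\<in>W. sadd a w \<in> G"
    using G(1)[unfolded open_roumieu_def, THEN conjunct2, rule_format, OF a] by (elim exE conjE)
  obtain l where l: "l > 0" "seq_bdd \<omega> l v" using v(1) by (auto simp: Lambda_roumieu_def)
  obtain \<epsilon> where \<epsilon>: "\<epsilon> > 0" "\<And>b. seq_bdd \<omega> l b \<Longrightarrow> snorm \<omega> l b < \<epsilon> \<Longrightarrow> b \<in> W"
    using W(1) l(1) by blast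
  obtain C where C: "\<And>\<alpha>. norm (v \<alpha>) * fact (mlen \<alpha>) \<le> C * wgt \<omega> l (mlen \<alpha>)"
    using l(2) unfolding seq_bdd_def by blast
  define z where "z = complex_of_real (\<epsilon> / (\<bar>C\<bar> + 1))"
  have "\<epsilon> / (\<bar>C\<bar> + 1) \<noteq> 0" using \<epsilon>(1) by (simp add: add_nonneg_eq_0_iff)
  then have z: "z \<noteq> 0" unfolding z_def of_real_eq_0_iff .
  have "snorm \<omega> l (sscale z v) \<le> norm z * C" by (intro snorm_le sscale_bound C)
  also have "\<dots> < \<epsilon>"
  proof -
    have "\<epsilon> * C < \<epsilon> * (\<bar>C\<bar> + 1)" using \<epsilon>(1) by (intro mult_strict_left_mono) auto
    moreover have "norm z = \<epsilon> / (\<bar>C\<bar> + 1)" unfolding z_def norm_of_real using \<epsilon>(1) by simp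
    ultimately show ?thesis by (simp add: pos_divide_less_eq)
  qed
  finally have "sadd a (sscale z v) \<in> G"
    using \<epsilon>(2) W(2) seq_bdd_sscale[OF l(2)] by blast
  moreover have False if "a \<in> N" "sadd a (sscale z v) \<in> N"
  proof -
    have "sscale (1 / z) (sadd (sadd a (sscale z v)) (sscale (- 1) a)) \<in> N"
      by (rule scale[OF add[OF that(2) scale[OF that(1)]]])
    also have "sscale (1 / z) (sadd (sadd a (sscale z v)) (sscale (- 1) a)) = v"
      using z by (simp add: sscale_def sadd_def)
    finally show False using v(2) by simp
  qed
  ultimately show "G \<inter> (Lambda_roumieu \<omega> - N) \<noteq> {}" using a sub by blast
qed

section \<open>Gap series inside the sequence spaces\<close>

lemma seq_bdd_of_ray:
  assumes "\<And>j. norm (c j) \<le> C * wgt \<omega> l j"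
  shows "seq_bdd \<omega> l (of_ray c :: ('n::finite \<Rightarrow> nat) \<Rightarrow> complex)"
  unfolding seq_bdd_def
proof (intro exI[of _ C] allI)
  fix \<alpha> :: "'n \<Rightarrow> nat"
  have "0 \<le> C * wgt \<omega> l (mlen \<alpha>)" using assms norm_ge_zero order_trans by blast
  then show "norm (of_ray c \<alpha>) * fact (mlen \<alpha>) \<le> C * wgt \<omega> l (mlen \<alpha>)"
    using assms[of "mlen \<alpha>"] by (auto simp: of_ray_def norm_divide)
qed

lemma lineable_Lambda_roumieu:
  assumes "W_class \<sigma>" "quasianalytic \<sigma>" and \<omega>: "W_class \<omega>" "Liminf at_top (\<lambda>t. ereal (\<omega> t / t)) = 0"
  shows "lineable (Lambda_roumieu \<omega> - ray_quasianalytic \<sigma> :: (('n::finite \<Rightarrow> nat) \<Rightarrow> complex) set)"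
proof (rule lineable_ray[OF assms(1,2) superanalytic_wgt[OF \<omega>]])
  fix K and c :: "nat \<Rightarrow> complex"
  assume "\<And>j. norm (c j) \<le> K * wgt \<omega> 1 j"
  then show "of_ray c \<in> Lambda_roumieu \<omega>"
    unfolding Lambda_roumieu_def using seq_bdd_of_ray zero_less_one by blast
qed

lemma lineable_Lambda_beurling:
  assumes "W_class \<sigma>" "quasianalytic \<sigma>" and \<omega>: "W_class \<omega>" "\<omega> \<in> o[at_top](\<lambda>t. t)"
  shows "lineable (Lambda_beurling \<omega> - ray_quasianalytic \<sigma> :: (('n::finite \<Rightarrow> nat) \<Rightarrow> complex) set)"
proof -
  obtain u where u: "superanalytic u" "\<And>l. l > 0 \<Longrightarrow> \<exists>C. \<forall>j. u j \<le> C * wgt \<omega> l j"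
    using superanalytic_beurling[OF \<omega>] by blast
  show ?thesis
  proof (rule lineable_ray[OF assms(1,2) u(1)])
    fix K and c :: "nat \<Rightarrow> complex"
    assume c: "\<And>j. norm (c j) \<le> K * u j"
    have u0: "u j > 0" for j using u(1) by (simp add: superanalytic_def)
    have K: "K \<ge> 0"
      using order_trans[OF norm_ge_zero c[of 0]] u0[of 0] by (simp add: zero_le_mult_iff)
    have "seq_bdd \<omega> l (of_ray c :: ('n \<Rightarrow> nat) \<Rightarrow> complex)" if l: "l > 0" for l
    proof -
      obtain C where C: "\<And>j. u j \<le> C * wgt \<omega> l j" using u(2)[OF l] by blast
      have "norm (c j) \<le> K * C * wgt \<omega> l j" for j
        using order_trans[OF c mult_left_mono[OF C K]] by (simp add: mult.assoc)
      then show ?thesis by (rule seq_bdd_of_ray)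
    qed
    then show "of_ray c \<in> (Lambda_beurling \<omega> :: (('n \<Rightarrow> nat) \<Rightarrow> complex) set)" by (auto simp: Lambda_beurling_def)
  qed
qed

theorem mainTheorem15:
  fixes \<sigma> :: "real \<Rightarrow> real"
  assumes "W_class \<sigma>" and "quasianalytic \<sigma>"
  shows
   "(\<forall>\<omega>. W_class \<omega> \<and> quasianalytic \<omega> \<and> \<omega> \<in> o[at_top](\<lambda>t. t) \<longrightarrow>
        meager_beurling \<omega> ((jet_germs_roumieu \<sigma> :: (('n::finite \<Rightarrow> nat) \<Rightarrow> complex) set) \<inter> Lambda_beurling \<omega>) \<and>
        haar_null_beurling \<omega> ((jet_germs_roumieu \<sigma> :: (('n \<Rightarrow> nat) \<Rightarrow> complex) set) \<inter> Lambda_beurling \<omega>))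
  \<and> (\<forall>\<omega>. W_class \<omega> \<and> quasianalytic \<omega> \<and> \<omega> \<in> O[at_top](\<lambda>t. t) \<and>
          Liminf at_top (\<lambda>t. ereal (\<omega> t / t)) = 0 \<longrightarrow>
        dense_roumieu \<omega> (Lambda_roumieu \<omega> - (jet_germs_roumieu \<sigma> :: (('n \<Rightarrow> nat) \<Rightarrow> complex) set)) \<and>
        dense_roumieu \<omega> (Lambda_roumieu \<omega> - (jet_germs_beurling \<sigma> :: (('n \<Rightarrow> nat) \<Rightarrow> complex) set)))
  \<and> (\<forall>\<omega>. W_class \<omega> \<and> quasianalytic \<omega> \<and> \<omega> \<in> O[at_top](\<lambda>t. t) \<and>
          Liminf at_top (\<lambda>t. ereal (\<omega> t / t)) = 0 \<longrightarrow>
        lineable (Lambda_roumieu \<omega> - (jet_germs_roumieu \<sigma> :: (('n \<Rightarrow> nat) \<Rightarrow> complex) set)) \<and>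
        lineable (Lambda_roumieu \<omega> - (jet_germs_beurling \<sigma> :: (('n \<Rightarrow> nat) \<Rightarrow> complex) set)))
  \<and> (\<forall>\<omega>. W_class \<omega> \<and> quasianalytic \<omega> \<and> \<omega> \<in> o[at_top](\<lambda>t. t) \<longrightarrow>
        lineable (Lambda_beurling \<omega> - (jet_germs_roumieu \<sigma> :: (('n \<Rightarrow> nat) \<Rightarrow> complex) set)) \<and>
        lineable (Lambda_beurling \<omega> - (jet_germs_beurling \<sigma> :: (('n \<Rightarrow> nat) \<Rightarrow> complex) set)))"
proof -
  let ?N = "ray_quasianalytic \<sigma> :: (('n \<Rightarrow> nat) \<Rightarrow> complex) set"
  let ?P = "\<lambda>n::nat. {b :: ('n \<Rightarrow> nat) \<Rightarrow> complex. ray b \<in> ray_jets \<sigma> (real (Suc n))}"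
  have N: "?N = (\<Union>n. ?P n)" by (rule ray_quasianalytic_def)
  have closed: "closed (?P n)" for n by (rule closed_ray_preimage) simp
  have add: "sadd a b \<in> ?N" if "a \<in> ?N" "b \<in> ?N" for a b
    by (rule ray_quasianalytic_sadd[OF assms(1) that])
  have scale: "sscale z a \<in> ?N" if "a \<in> ?N" for a z
    by (rule ray_quasianalytic_sscale[OF assms(1) that])
  have R: "jet_germs_roumieu \<sigma> \<subseteq> ?N"
    by (rule jet_germs_subset_ray_quasianalytic[OF assms(1)])
  then have B: "jet_germs_beurling \<sigma> \<subseteq> ?N"
    using jet_germs_beurling_subset_roumieu by blast
  have beurling: "meager_beurling \<omega> (jet_germs_roumieu \<sigma> \<inter> Lambda_beurling \<omega> :: (('n \<Rightarrow> nat) \<Rightarrow> complex) set)"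
    "haar_null_beurling \<omega> (jet_germs_roumieu \<sigma> \<inter> Lambda_beurling \<omega> :: (('n \<Rightarrow> nat) \<Rightarrow> complex) set)"
    if \<omega>: "W_class \<omega>" "\<omega> \<in> o[at_top](\<lambda>t. t)" for \<omega>
  proof -
    \<comment> \<open>Lineability is used here only to produce one vector outside the
      subspace.\<close>
    obtain v where v: "v \<in> Lambda_beurling \<omega>" "v \<notin> ?N"
      using lineable_nonempty[OF lineable_Lambda_beurling[OF assms \<omega>]] by blast
    show "meager_beurling \<omega> (jet_germs_roumieu \<sigma> \<inter> Lambda_beurling \<omega> :: (('n \<Rightarrow> nat) \<Rightarrow> complex) set)"
      by (rule meager_beurling_subspace[where P = ?P, OF closed add[unfolded N] scale[unfolded N]
            v[unfolded N] order_trans[OF Int_lower1 R[unfolded N]]])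
    show "haar_null_beurling \<omega> (jet_germs_roumieu \<sigma> \<inter> Lambda_beurling \<omega> :: (('n \<Rightarrow> nat) \<Rightarrow> complex) set)"
      by (rule haar_null_beurling_subspace[where P = ?P, OF closed add[unfolded N] scale[unfolded N]
            v[unfolded N] Int_mono[OF R[unfolded N] order_refl]])
  qed
  have dense: "dense_roumieu \<omega> (Lambda_roumieu \<omega> - ?N)"
    if \<omega>: "W_class \<omega>" "Liminf at_top (\<lambda>t. ereal (\<omega> t / t)) = 0" for \<omega>
  proof -
    obtain v where "v \<in> Lambda_roumieu \<omega>" "v \<notin> ?N"
      using lineable_nonempty[OF lineable_Lambda_roumieu[OF assms \<omega>]] by blast
    then show ?thesis by (intro dense_roumieu_subspace add scale)
  qed
  show ?thesis
    by (intro conjI allI impI; elim conjE;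
        rule beurling dense_roumieu_mono[OF dense Diff_mono[OF order_refl R]]
          dense_roumieu_mono[OF dense Diff_mono[OF order_refl B]]
          lineable_mono[OF lineable_Lambda_roumieu[OF assms] Diff_mono[OF order_refl R]]
          lineable_mono[OF lineable_Lambda_roumieu[OF assms] Diff_mono[OF order_refl B]]
          lineable_mono[OF lineable_Lambda_beurling[OF assms] Diff_mono[OF order_refl R]]
          lineable_mono[OF lineable_Lambda_beurling[OF assms] Diff_mono[OF order_refl B]];
        assumption)
qed

end
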